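(* Let $r_0>0$, let $U\subset\mathbb{R}^m$ be open, and let $F_{1,\lambda},\dots,F_{N,\lambda}$ be holomorphic functions on the ball $B_c(0,1+r_0)\subset\mathbb{C}^n$ depending real-analytically on the parameter $\lambda\in U$. Let $V_\lambda$ be the complex linear span of $F_{1,\lambda},\dots,F_{N,\lambda}$. Then there is a constant $d(n)$ depending only on $n$ such that for any compact set $K\subset U$ there is a constant $\gamma=\gamma(K,r_0)>0$ with $$\sup_{B(x,\rho)}|F|\le\left(\frac{d(n)\,|B(x,\rho)|}{|\omega|}\right)^{\gamma}\sup_{\omega}|F|$$ for every $\lambda\in K$, every $F\in V_\lambda$, every real ball $B(x,\rho)\subset B(0,1)\subset\mathbb{R}^n$ and every measurable subset $\omega\subset B(x,\rho)$.
   Context: $\mathbb{R}^n$ is identified with the real points of $\mathbb{C}^n$. $B(x,\rho)$ denotes the Euclidean ball in $\mathbb{R}^n$ and $B_c(x,\rho)$ the Euclidean ball in $\mathbb{C}^n$ with center $x$ and radius $\rho$. $|\cdot|$ denotes Lebesgue measure on $\mathbb{R}^n$. *)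

theory Defs
  imports "HOL-Analysis.Analysis"
begin

definition cvec :: "real ^ 'n \<Rightarrow> complex ^ 'n" where
  "cvec y = (\<chi> i. complex_of_real (y $ i))"

definition holo_n :: "(complex ^ 'n) set \<Rightarrow> (complex ^ 'n \<Rightarrow> complex) \<Rightarrow> bool" where
  "holo_n S f \<longleftrightarrow> (\<forall>z\<in>S. \<exists>D. (f has_derivative D) (at z) \<and>
      (\<forall>(c::complex) v. D (c *s v) = c * D v))"

definition Rm :: "nat \<Rightarrow> (nat \<Rightarrow> real) set" where
  "Rm m = {l. \<forall>i\<ge>m. l i = 0}"

definition distm :: "nat \<Rightarrow> (nat \<Rightarrow> real) \<Rightarrow> (nat \<Rightarrow> real) \<Rightarrow> real" where
  "distm m a l = sqrt (\<Sum>i<m. (l i - a i)^2)"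

definition open_Rm :: "nat \<Rightarrow> (nat \<Rightarrow> real) set \<Rightarrow> bool" where
  "open_Rm m U \<longleftrightarrow> U \<subseteq> Rm m \<and>
     (\<forall>a\<in>U. \<exists>e>0. \<forall>l\<in>Rm m. distm m a l < e \<longrightarrow> l \<in> U)"

text \<open>(lambda, z) \<mapsto> F lambda z is analytic jointly: real-analytic in lambda \<in> U \<subseteq> R^m
  and holomorphic in z \<in> S, i.e. locally a convergent mixed power series
  \<Sum> c_{\<alpha>\<beta>} (lambda - a)^\<alpha> (z - w)^\<beta>.\<close>
definition param_analytic :: "nat \<Rightarrow> (nat \<Rightarrow> real) set \<Rightarrow> (complex ^ 'n) set \<Rightarrow>
    ((nat \<Rightarrow> real) \<Rightarrow> complex ^ 'n \<Rightarrow> complex) \<Rightarrow> bool" where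
  "param_analytic m U S F \<longleftrightarrow>
    (\<forall>a\<in>U. \<forall>w\<in>S. \<exists>r>0. \<exists>c :: (nat \<Rightarrow> nat) \<times> ('n \<Rightarrow> nat) \<Rightarrow> complex.
       \<forall>l\<in>U. \<forall>z\<in>S. distm m a l < r \<and> dist z w < r \<longrightarrow>
         ((\<lambda>(\<alpha>, \<beta>). c (\<alpha>, \<beta>) * (\<Prod>i<m. complex_of_real (l i - a i) ^ \<alpha> i)
                        * (\<Prod>k\<in>UNIV. (z $ k - w $ k) ^ \<beta> k))
           has_sum F l z) ({\<alpha>. \<forall>i\<ge>m. \<alpha> i = 0} \<times> UNIV))"

end

theory Submission
  imports Defs "HOL-Complex_Analysis.Complex_Analysis"
begin

text \<open>
  Restrict \<open>F\<close> to short segments \<open>t \<mapsto> y + t v\<close> and regard the coefficients of the linear combination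
  as further parameters. The result is one power series \<open>G(\<nu>, t)\<close> in the parameters \<open>\<nu>\<close> whose
  coefficients are holomorphic in \<open>t\<close>. The scalar series that are bounded by
  finitely many of the values \<open>|G(\<nu>, \<tau>)|\<close>, \<open>\<tau> \<in> [0, 1]\<close>, form an ideal; by Dickson's lemma it has
  a finite standard basis, and division of \<open>G\<close> by this basis leaves a remainder that vanishes for
  \<open>t \<in> [0, 1]\<close>, hence for all \<open>t\<close>. So \<open>|G(\<nu>, t)| \<le> C max |G(\<nu>, \<tau>)|\<close> uniformly in \<open>\<nu>\<close>, although
  the dimension of the span may drop. Compactness makes this Bernstein
  inequality uniform in \<open>\<lambda>\<close> and \<open>y\<close>. Lagrange interpolation at separated points of a set \<open>E\<close> and the
  maximum principle turn it into a Remez inequality on segments, and Fubini's theorem supplies, for every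
  \<open>y\<close> in the ball, a segment from \<open>y\<close> on which \<open>\<omega>\<close> has length at least a multiple of the square of
  its relative measure. As \<open>\<gamma>\<close> may be large, every remaining constant is absorbed with \<open>d = 2\<close>.
\<close>

section \<open>Standard bases of ideals of power series\<close>

text \<open>The obstacle is degeneration. If the functions stayed independent, compactness of the
  unit sphere of coefficients would give a uniform Bernstein constant; where they become dependent,
  the quotient of the two suprema is 0/0 and that argument breaks down. With the coefficients as
  parameters the question concerns one germ at the origin, and finiteness comes from Dickson's lemma
  instead. It is therefore bounded by finitely many values, so a nonzero remainder would have its
  leading index in the ideal, whereas division has removed all such indices. The disc of radius 5 is
  chosen for the Remez step: on the circle of radius 4 every node in [0, 1] is at distance at least
  3. Each interpolation node thus gains a factor 3, and \<open>k + 1\<close> nodes outweigh a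
  Bernstein constant of size \<open>3 ^ k\<close>. This \<open>k\<close> is the main source of the
  exponent.\<close>

lemma summable_on_double_series:
  fixes f :: "'a \<Rightarrow> 'b \<Rightarrow> 'c::banach" and M :: "'a \<Rightarrow> 'b \<Rightarrow> real"
  assumes "\<And>m n. m \<in> A \<Longrightarrow> n \<in> B \<Longrightarrow> norm (f m n) \<le> M m n"
    and "\<And>m. m \<in> A \<Longrightarrow> (M m has_sum R m) B" and "R summable_on A"
  shows "(\<lambda>(m, n). f m n) summable_on (A \<times> B)"
proof -
  have "(\<lambda>(m,n). M m n) summable_on (A \<times> B)"
  proof (rule summable_on_SigmaI)
    fix x y assume "x \<in> A" "y \<in> B"
    then show "0 \<le> (case (x,y) of (m,n) \<Rightarrow> M m n)"
      using order_trans[OF norm_ge_zero assms(1)[of x y]] by simp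
  qed (use assms in auto)
  then have "(\<lambda>p. norm (case p of (m,n) \<Rightarrow> f m n)) summable_on (A \<times> B)"
    by (rule Infinite_Sum.abs_summable_on_comparison_test') (use assms in auto)
  then show ?thesis by (rule abs_summable_summable)
qed

text \<open>
  Division by a standard basis is a triangular system for the quotients and the remainder, because
  the leading index is the least one; no convergence is needed to solve it.
\<close>

fun triangular_solution :: "(nat \<Rightarrow> nat \<Rightarrow> 'a::comm_ring) \<Rightarrow> (nat \<Rightarrow> 'a) \<Rightarrow> nat \<Rightarrow> 'a" where
  "triangular_solution K c n = c n - (\<Sum>m<n. K m n * triangular_solution K c m)"

declare triangular_solution.simps [simp del]

text \<open>Replacing \<open>K\<close> by minus its norm turns the subtraction into an addition of
  nonnegative terms, so the same recursion produces a majorant.\<close>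

lemma norm_triangular_solution_le:
  fixes c :: "nat \<Rightarrow> complex" and b :: "nat \<Rightarrow> real"
  assumes "\<And>k. norm (c k) \<le> b k"
  shows "norm (triangular_solution K c n) \<le> triangular_solution (\<lambda>m n. - norm (K m n)) b n"
proof (induction n rule: less_induct)
  case (less n)
  have "norm (triangular_solution K c n)
      \<le> norm (c n) + norm (\<Sum>m<n. K m n * triangular_solution K c m)"
    by (subst triangular_solution.simps) (rule norm_triangle_ineq4)
  also have "norm (\<Sum>m<n. K m n * triangular_solution K c m)
      \<le> (\<Sum>m<n. norm (K m n) * triangular_solution (\<lambda>m n. - norm (K m n)) b m)"
    using less by (intro sum_norm_le) (simp add: norm_mult mult_left_mono)
  finally show ?case
    using assms[of n] by (subst triangular_solution.simps) (simp add: sum_negf)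
qed

text \<open>In the weighted l1 norm the strictly triangular operator has norm at most 1/2, because
  each of its columns has; inverting it from the identity costs a factor 2. Truncation at
  \<open>X\<close> keeps every sum finite, so half of the left side can be moved across.\<close>

lemma triangular_solution_weighted_sum_le:
  fixes k :: "nat \<Rightarrow> nat \<Rightarrow> real"
  assumes "\<And>m n. k m n \<ge> 0" "\<And>n. b n \<ge> 0" "\<And>n. w n \<ge> 0"
    and col: "\<And>m X. (\<Sum>n\<in>{m<..<X}. k m n * w n) \<le> w m / 2"
  defines "h \<equiv> triangular_solution (\<lambda>m n. - k m n) b"
  shows "(\<Sum>n<X. h n * w n) \<le> 2 * (\<Sum>n<X. b n * w n)"
proof -
  have h: "h n = b n + (\<Sum>m<n. k m n * h m)" for n
    unfolding h_def by (subst triangular_solution.simps) (simp add: sum_negf)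
  have nn: "h n \<ge> 0" for n
  proof (induction n rule: less_induct)
    case (less n) then show ?case by (subst h) (auto intro!: add_nonneg_nonneg sum_nonneg mult_nonneg_nonneg assms(1,2))
  qed
  have "(\<Sum>n<X. h n * w n) = (\<Sum>n<X. b n * w n) + (\<Sum>n<X. \<Sum>m<n. k m n * h m * w n)"
    by (subst h) (simp add: distrib_right sum.distrib sum_distrib_right)
  also have "(\<Sum>n<X. \<Sum>m<n. k m n * h m * w n) = (\<Sum>m<X. h m * (\<Sum>n\<in>{m<..<X}. k m n * w n))"
  proof -
    have "(\<Sum>n<X. \<Sum>m<n. k m n * h m * w n) = (\<Sum>n\<in>{..<X}. \<Sum>m\<in>{m. m \<in> {..<X} \<and> m < n}. k m n * h m * w n)"
      by (intro sum.cong) auto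
    also have "\<dots> = (\<Sum>m\<in>{..<X}. \<Sum>n\<in>{n. n \<in> {..<X} \<and> m < n}. k m n * h m * w n)"
      by (rule sum.swap_restrict) auto
    also have "\<dots> = (\<Sum>m<X. h m * (\<Sum>n\<in>{m<..<X}. k m n * w n))"
      unfolding sum_distrib_left by (intro sum.cong) auto
    finally show ?thesis .
  qed
  also have "\<dots> \<le> (\<Sum>m<X. h m * (w m / 2))"
    by (intro sum_mono mult_left_mono col nn)
  also have "\<dots> = (\<Sum>n<X. h n * w n) / 2" by (simp add: sum_divide_distrib)
  finally show ?thesis by linarith
qed

text \<open>On small polydiscs a series is dominated by its leading monomial.\<close>

lemma tail_weight_small:
  fixes u :: "nat \<Rightarrow> real"
  assumes u: "\<And>d. u d \<ge> 0" and sm: "(\<lambda>n. u n / real n ^ s1) summable_on S" and b: "b > 0"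
  shows "\<exists>s'\<ge>s1. \<forall>s\<ge>s'. \<forall>F. finite F \<longrightarrow> F \<subseteq> S \<inter> {b<..} \<longrightarrow> (\<Sum>d\<in>F. u d * (real b / real d) ^ s) \<le> 1/2"
proof -
  \<comment> \<open>Indices are integers, so every \<open>d > b\<close> is at least
    \<open>Suc b\<close> and \<open>b / d \<le> \<theta> < 1\<close>. Of the \<open>s\<close>
    factors, \<open>s1\<close> are kept for summability and the others provide the decay.\<close>
  define \<theta> where "\<theta> = real b / real (Suc b)"
  have \<theta>: "0 \<le> \<theta>" "\<theta> < 1" unfolding \<theta>_def using b by (auto simp: field_simps)
  define Z where "Z = infsum (\<lambda>n. u n / real n ^ s1) S"
  have Z: "Z \<ge> 0" unfolding Z_def by (intro infsum_nonneg) (auto intro!: u divide_nonneg_nonneg)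
  have "(\<lambda>j. Z * real b ^ s1 * \<theta> ^ j) \<longlonglongrightarrow> Z * real b ^ s1 * 0"
    by (intro tendsto_intros LIMSEQ_realpow_zero \<theta>)
  then have "eventually (\<lambda>j. Z * real b ^ s1 * \<theta> ^ j < 1/2) sequentially"
    by (rule order_tendstoD) auto
  then obtain J where J: "\<And>j. j \<ge> J \<Longrightarrow> Z * real b ^ s1 * \<theta> ^ j < 1/2"
    by (auto simp: eventually_sequentially)
  show ?thesis
  proof (intro exI[of _ "s1 + J"] conjI allI impI)
    fix s F assume s: "s \<ge> s1 + J" and F: "finite F" "F \<subseteq> S \<inter> {b<..}"
    have "(\<Sum>d\<in>F. u d * (real b / real d) ^ s) \<le> (\<Sum>d\<in>F. (u d / real d ^ s1) * (real b ^ s1 * \<theta> ^ (s - s1)))"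
    proof (rule sum_mono)
      fix d assume "d \<in> F"
      then have d: "d > b" using F by auto
      have "(real b / real d) ^ s = (real b / real d) ^ s1 * (real b / real d) ^ (s - s1)"
        using s by (simp flip: power_add)
      also have "\<dots> \<le> (real b / real d) ^ s1 * \<theta> ^ (s - s1)"
        unfolding \<theta>_def using d by (intro mult_left_mono power_mono divide_left_mono) auto
      finally have "u d * (real b / real d) ^ s \<le> u d * ((real b / real d) ^ s1 * \<theta> ^ (s - s1))"
        using u by (intro mult_left_mono)
      then show "u d * (real b / real d) ^ s \<le> (u d / real d ^ s1) * (real b ^ s1 * \<theta> ^ (s - s1))"
        by (simp add: power_divide field_simps)
    qed
    also have "\<dots> = (\<Sum>d\<in>F. u d / real d ^ s1) * (real b ^ s1 * \<theta> ^ (s - s1))"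
      by (simp add: sum_distrib_right)
    also have "\<dots> \<le> Z * (real b ^ s1 * \<theta> ^ (s - s1))"
      unfolding Z_def using F \<theta> by (intro mult_right_mono finite_sum_le_infsum sm) (auto intro!: u divide_nonneg_nonneg)
    also have "\<dots> \<le> 1/2"
    proof -
      have "J \<le> s - s1" using s by simp
      from J[OF this] show ?thesis by (simp add: mult_ac)
    qed
    finally show "(\<Sum>d\<in>F. u d * (real b / real d) ^ s) \<le> 1/2" .
  qed auto
qed

text \<open>
  Monomials in parameters \<open>\<nu>\<^sub>p\<close> indexed by primes are encoded as natural numbers: \<open>\<Prod> \<nu>\<^sub>p ^ \<alpha>\<^sub>p\<close> becomes
  \<open>n = \<Prod> p ^ \<alpha>\<^sub>p\<close>. Products and divisibility agree, the order of the naturals is a monomial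
  order, and the polydisc \<open>|\<nu>\<^sub>p| \<le> p ^ (-s)\<close> gives the monomial the weight \<open>n ^ (-s)\<close>.
\<close>

definition smooth_numbers :: "nat set \<Rightarrow> nat set" where
  "smooth_numbers P = {n. n > 0 \<and> prime_factors n \<subseteq> P}"

lemma smooth_numbers_pos: "n \<in> smooth_numbers P \<Longrightarrow> n > 0"
  by (simp add: smooth_numbers_def)

lemma smooth_numbers_mult_iff:
  "m * n \<in> smooth_numbers P \<longleftrightarrow> m \<in> smooth_numbers P \<and> n \<in> smooth_numbers P"
  by (auto simp: smooth_numbers_def prime_factors_product)

lemma one_in_smooth_numbers: "1 \<in> smooth_numbers P"
  by (simp add: smooth_numbers_def)

lemma smooth_numbers_insertE:
  assumes "n \<in> smooth_numbers (insert p P)" "prime p"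
  obtains e n' where "n = p ^ e * n'" "n' \<in> smooth_numbers P"
proof -
  have n: "n > 0" "prime_factors n \<subseteq> insert p P" using assms by (auto simp: smooth_numbers_def)
  then obtain n' where n': "n = p ^ multiplicity p n * n'" "\<not> p dvd n'"
    using multiplicity_decompose'[of n p] assms(2) not_prime_unit by (metis gr_implies_not0)
  then have "n' > 0" using n by (metis gr0I mult_0_right)
  moreover have "prime_factors n' \<subseteq> P"
  proof
    fix q assume q: "q \<in> prime_factors n'"
    then have "q \<noteq> p" using n' by (metis in_prime_factors_iff)
    moreover have "q dvd n" using q n'(1) by (metis dvd_mult in_prime_factors_iff)
    then have "q \<in> prime_factors n" using q n by (auto simp: in_prime_factors_iff)
    ultimately show "q \<in> P" using n by auto
  qed
  ultimately show thesis using that n' by (auto simp: smooth_numbers_def)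
qed

text \<open>Induction on the set of primes, slicing \<open>A\<close> by the exponent of
  \<open>p\<close>. A basis \<open>B0\<close> of the union of all slices, each member lifted with an
  exponent at which it occurs, serves all exponents from \<open>E\<close> on; each of the finitely
  many lower slices contributes its own basis.\<close>

lemma dickson_smooth_numbers:
  assumes "finite P" "\<And>p. p \<in> P \<Longrightarrow> prime p" "A \<subseteq> smooth_numbers P"
  shows "\<exists>B. finite B \<and> B \<subseteq> A \<and> (\<forall>a\<in>A. \<exists>b\<in>B. b dvd a)"
  using assms
proof (induction P arbitrary: A rule: finite_induct)
  case empty
  have "smooth_numbers {} \<subseteq> {1}" using prime_factorization_empty_iff
    by (auto simp: smooth_numbers_def prime_factorization_empty_iff)
  with empty have "finite A" by (meson finite.emptyI finite.insertI finite_subset order_trans)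
  then show ?case by (intro exI[of _ A]) (auto intro: dvd_refl)
next
  case (insert p P)
  define Q where "Q e = {a. a \<in> smooth_numbers P \<and> p ^ e * a \<in> A}" for e
  have IH: "\<exists>B. finite B \<and> B \<subseteq> X \<and> (\<forall>a\<in>X. \<exists>b\<in>B. b dvd a)" if "X \<subseteq> smooth_numbers P" for X
    using insert that by auto
  have "(\<Union>e. Q e) \<subseteq> smooth_numbers P" by (auto simp: Q_def)
  then obtain B0 where B0: "finite B0" "B0 \<subseteq> (\<Union>e. Q e)" "\<forall>a\<in>(\<Union>e. Q e). \<exists>b\<in>B0. b dvd a"
    using IH by metis
  then obtain \<epsilon> where \<epsilon>: "\<And>b. b \<in> B0 \<Longrightarrow> b \<in> Q (\<epsilon> b)" by (metis UN_E subsetD)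
  have "\<forall>e. \<exists>B. finite B \<and> B \<subseteq> Q e \<and> (\<forall>a\<in>Q e. \<exists>b\<in>B. b dvd a)"
    by (intro allI IH) (auto simp: Q_def)
  then obtain B1 where B1: "\<And>e. finite (B1 e)" "\<And>e. B1 e \<subseteq> Q e" "\<And>e a. a \<in> Q e \<Longrightarrow> \<exists>b\<in>B1 e. b dvd a"
    by metis
  define E where "E = Max (insert 0 (\<epsilon> ` B0))"
  have E: "\<epsilon> b \<le> E" if "b \<in> B0" for b unfolding E_def using that B0(1) by (intro Max_ge) auto
  define B where "B = (\<lambda>b. p ^ \<epsilon> b * b) ` B0 \<union> (\<Union>e<E. (\<lambda>b. p ^ e * b) ` B1 e)"
  show ?case
  proof (intro exI[of _ B] conjI ballI)
    show "finite B" unfolding B_def using B0 B1 by auto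
    show "B \<subseteq> A" unfolding B_def using \<epsilon> B1(2) by (auto simp: Q_def)
    fix a assume a: "a \<in> A"
    then obtain e a' where a': "a = p ^ e * a'" "a' \<in> smooth_numbers P"
      using smooth_numbers_insertE insert.prems by (metis insertI1 subsetD)
    then have aQ: "a' \<in> Q e" using a by (auto simp: Q_def)
    show "\<exists>b\<in>B. b dvd a"
    proof (cases "e < E")
      case True
      obtain b where "b \<in> B1 e" "b dvd a'" using B1(3)[OF aQ] by auto
      then show ?thesis using True a' unfolding B_def by (intro bexI[of _ "p ^ e * b"]) auto
    next
      case False
      obtain b where b: "b \<in> B0" "b dvd a'" using B0(3) aQ by blast
      then have "p ^ \<epsilon> b * b dvd p ^ e * a'" using E[OF b(1)] False
        by (intro mult_dvd_mono le_imp_power_dvd) auto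
      then show ?thesis using b a' unfolding B_def by auto
    qed
  qed
qed

text \<open>These stand for the evaluation of all monomials at a point of a small polydisc. Division
  only uses that the values multiply and how fast they decay.\<close>

definition characters :: "nat set \<Rightarrow> nat \<Rightarrow> (nat \<Rightarrow> complex) set" where
  "characters S s = {\<psi>. (\<forall>m\<in>S. \<forall>n\<in>S. \<psi> (m * n) = \<psi> m * \<psi> n) \<and> (\<forall>n\<in>S. norm (\<psi> n) \<le> 1 / real n ^ s)}"

lemma character_series:
  fixes f :: "nat \<Rightarrow> complex"
  assumes "\<psi> \<in> characters S s" "\<And>n. n \<in> S \<Longrightarrow> norm (f n) \<le> b n"
    and sm: "(\<lambda>n. b n / real n ^ s) summable_on S"
  shows "(\<lambda>n. \<psi> n * f n) summable_on S"
    and "norm (\<Sum>\<^sub>\<infinity>n\<in>S. \<psi> n * f n) \<le> (\<Sum>\<^sub>\<infinity>n\<in>S. b n / real n ^ s)"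
proof -
  have le: "norm (\<psi> n * f n) \<le> b n / real n ^ s" if "n \<in> S" for n
  proof -
    have "norm (\<psi> n * f n) \<le> 1 / real n ^ s * b n"
      unfolding norm_mult by (rule mult_mono) (use assms that in \<open>auto simp: characters_def\<close>)
    then show ?thesis by simp
  qed
  then have "(\<lambda>n. norm (\<psi> n * f n)) summable_on S"
    by (intro Infinite_Sum.abs_summable_on_comparison_test'[OF sm])
  then show 1: "(\<lambda>n. \<psi> n * f n) summable_on S" by (rule abs_summable_summable)
  show "norm (\<Sum>\<^sub>\<infinity>n\<in>S. \<psi> n * f n) \<le> (\<Sum>\<^sub>\<infinity>n\<in>S. b n / real n ^ s)"
    by (rule norm_infsum_le[OF has_sum_infsum[OF 1] has_sum_infsum[OF sm] le])
qed

text \<open>Multiplying a series by the monomial of index \<open>q\<close> moves its coefficients to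
  the multiples of \<open>q\<close>; this transfers sums across that shift.\<close>

lemma has_sum_multiples:
  fixes h :: "nat \<Rightarrow> 'a::{comm_monoid_add,topological_space}"
  assumes "\<And>m n. m * n \<in> S \<longleftrightarrow> m \<in> S \<and> n \<in> S" "q \<in> S" "q > 0"
  shows "((\<lambda>n. if q dvd n then h n else 0) has_sum X) S \<longleftrightarrow> ((\<lambda>d. h (q * d)) has_sum X) S"
proof -
  have "((\<lambda>n. if q dvd n then h n else 0) has_sum X) S \<longleftrightarrow> (h has_sum X) ((\<lambda>d. q * d) ` S)"
    by (rule has_sum_cong_neutral) (use assms in \<open>auto elim!: dvdE\<close>)
  also have "\<dots> \<longleftrightarrow> ((h \<circ> (\<lambda>d. q * d)) has_sum X) S"
    by (rule has_sum_reindex) (use assms in \<open>auto simp: inj_on_def\<close>)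
  finally show ?thesis by (simp add: o_def)
qed

text \<open>In the application \<open>E\<close> consists of the holomorphic functions on the disc
  \<open>D\<close> and \<open>T0\<close> is the real segment [0, 1]: \<open>uniq\<close> is the
  identity theorem, \<open>dickson\<close> the finiteness of monomial ideals, and \<open>b\<close>
  bounds the coefficient functions \<open>c\<close> uniformly on \<open>D\<close>.\<close>

locale controlled_series =
  fixes S :: "nat set" and E :: "('x \<Rightarrow> complex) set" and D T0 :: "'x set"
    and c :: "nat \<Rightarrow> 'x \<Rightarrow> complex" and b :: "nat \<Rightarrow> real" and s0 :: nat
  assumes pos: "n \<in> S \<Longrightarrow> n > 0"
    and mult_iff: "m * n \<in> S \<longleftrightarrow> m \<in> S \<and> n \<in> S"
    and dickson: "A \<subseteq> S \<Longrightarrow> \<exists>B. finite B \<and> B \<subseteq> A \<and> (\<forall>a\<in>A. \<exists>b\<in>B. b dvd a)"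
    and lin: "f \<in> E \<Longrightarrow> g \<in> E \<Longrightarrow> (\<lambda>x. f x - a * g x) \<in> E"
    and uniq: "f \<in> E \<Longrightarrow> (\<And>t. t \<in> T0 \<Longrightarrow> f t = 0) \<Longrightarrow> x \<in> D \<Longrightarrow> f x = 0"
    and T0: "T0 \<subseteq> D"
    and c_in: "c n \<in> E"
    and c_le: "n \<in> S \<Longrightarrow> x \<in> D \<Longrightarrow> norm (c n x) \<le> b n"
    and b_summable: "(\<lambda>n. b n / real n ^ s0) summable_on S"
    and b_nonneg: "b n \<ge> 0"
begin

definition ev :: "(nat \<Rightarrow> complex) \<Rightarrow> (nat \<Rightarrow> complex) \<Rightarrow> complex" where
  "ev \<psi> f = (\<Sum>\<^sub>\<infinity>n\<in>S. \<psi> n * f n)"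

definition G :: "(nat \<Rightarrow> complex) \<Rightarrow> 'x \<Rightarrow> complex" where
  "G \<psi> x = (\<Sum>\<^sub>\<infinity>n\<in>S. \<psi> n * c n x)"

definition controlled_by :: "nat \<Rightarrow> 'x set \<Rightarrow> real \<Rightarrow> (nat \<Rightarrow> complex) \<Rightarrow> bool" where
  "controlled_by s T C f \<longleftrightarrow> finite T \<and> T \<subseteq> T0 \<and> C \<ge> 0 \<and> (\<lambda>n. norm (f n) / real n ^ s) summable_on S \<and>
     (\<forall>\<psi>\<in>characters S s. norm (ev \<psi> f) \<le> C * (\<Sum>\<tau>\<in>T. norm (G \<psi> \<tau>)))"

text \<open>Quantifying over \<open>s\<close> makes this a property of germs at the origin: the
  bound is demanded on some small polydisc only, and the nodes \<open>T\<close> and the constant may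
  depend on the series.\<close>

definition controlled :: "(nat \<Rightarrow> complex) \<Rightarrow> bool" where
  "controlled f \<longleftrightarrow> (\<exists>s T C. controlled_by s T C f)"

lemma inverse_power_mono:
  assumes "n \<in> S" "s \<le> s'"
  shows "1 / real n ^ s' \<le> 1 / real n ^ s"
  using pos[OF assms(1)] assms(2) by (intro divide_left_mono power_increasing) auto

lemma characters_mono: "s \<le> s' \<Longrightarrow> characters S s' \<subseteq> characters S s"
  using inverse_power_mono unfolding characters_def by (auto intro: order_trans)

lemma weight_summable_mono:
  fixes a :: "nat \<Rightarrow> real"
  assumes "(\<lambda>n. a n / real n ^ s) summable_on S" "s \<le> s'" "\<And>n. a n \<ge> 0"
  shows "(\<lambda>n. a n / real n ^ s') summable_on S"
proof (rule summable_on_comparison_test[OF assms(1)])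
  fix n assume "n \<in> S"
  from mult_left_mono[OF inverse_power_mono[OF this assms(2)] assms(3)[of n]]
  show "a n / real n ^ s' \<le> a n / real n ^ s" by simp
qed (use assms in auto)

lemma controlled_by_mono:
  assumes "controlled_by s T C f" "s \<le> s'" "T \<subseteq> T'" "finite T'" "T' \<subseteq> T0" "C \<le> C'"
  shows "controlled_by s' T' C' f"
  unfolding controlled_by_def
proof (intro conjI ballI)
  have f: "C \<ge> 0" "(\<lambda>n. norm (f n) / real n ^ s) summable_on S"
    and le: "\<And>\<psi>. \<psi> \<in> characters S s \<Longrightarrow> norm (ev \<psi> f) \<le> C * (\<Sum>\<tau>\<in>T. norm (G \<psi> \<tau>))"
    using assms(1) by (auto simp: controlled_by_def)
  show "C' \<ge> 0" using f assms by simp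
  show "(\<lambda>n. norm (f n) / real n ^ s') summable_on S"
    by (rule weight_summable_mono[OF f(2) assms(2)]) auto
  fix \<psi> assume "\<psi> \<in> characters S s'"
  then have "norm (ev \<psi> f) \<le> C * (\<Sum>\<tau>\<in>T. norm (G \<psi> \<tau>))"
    using le characters_mono assms(2) by blast
  also have "\<dots> \<le> C' * (\<Sum>\<tau>\<in>T'. norm (G \<psi> \<tau>))"
    using assms f by (intro mult_mono sum_mono2 sum_nonneg) auto
  finally show "norm (ev \<psi> f) \<le> C' * (\<Sum>\<tau>\<in>T'. norm (G \<psi> \<tau>))" .
qed (use assms in auto)

lemma controlled_scale:
  assumes "controlled f"
  shows "controlled (\<lambda>n. a * f n)"
proof -
  obtain s T C where f: "controlled_by s T C f" using assms by (auto simp: controlled_def)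
  have "controlled_by s T (norm a * C) (\<lambda>n. a * f n)"
    unfolding controlled_by_def
  proof (intro conjI ballI)
    have "(\<lambda>n. norm a * (norm (f n) / real n ^ s)) summable_on S"
      using f by (intro summable_on_cmult_right) (auto simp: controlled_by_def)
    then show "(\<lambda>n. norm (a * f n) / real n ^ s) summable_on S" by (simp add: norm_mult)
    fix \<psi> assume \<psi>: "\<psi> \<in> characters S s"
    have "ev \<psi> (\<lambda>n. a * f n) = (\<Sum>\<^sub>\<infinity>n\<in>S. a * (\<psi> n * f n))" unfolding ev_def by (simp add: mult_ac)
    also have "\<dots> = a * ev \<psi> f" unfolding ev_def by (rule infsum_cmult_right')
    finally have "norm (ev \<psi> (\<lambda>n. a * f n)) = norm a * norm (ev \<psi> f)" by (simp add: norm_mult)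
    also have "\<dots> \<le> norm a * (C * (\<Sum>\<tau>\<in>T. norm (G \<psi> \<tau>)))"
      using f \<psi> by (intro mult_left_mono) (auto simp: controlled_by_def)
    finally show "norm (ev \<psi> (\<lambda>n. a * f n)) \<le> norm a * C * (\<Sum>\<tau>\<in>T. norm (G \<psi> \<tau>))" by (simp add: mult_ac)
  qed (use f in \<open>auto simp: controlled_by_def\<close>)
  then show ?thesis by (auto simp: controlled_def)
qed

lemma controlled_uniform:
  assumes "finite B" "\<And>p. p \<in> B \<Longrightarrow> controlled (g p)"
  shows "\<exists>s T C. finite T \<and> T \<subseteq> T0 \<and> C \<ge> 0 \<and> (\<forall>p\<in>B. controlled_by s T C (g p))"
  using assms
proof (induction rule: finite_induct)
  case empty
  show ?case by (intro exI[of _ 0] exI[of _ "{}"]) auto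
next
  case (insert p B)
  then obtain s T C where 1: "finite T" "T \<subseteq> T0" "C \<ge> 0" "\<forall>p\<in>B. controlled_by s T C (g p)" by auto
  obtain s' T' C' where 2: "controlled_by s' T' C' (g p)" using insert(4)[of p] by (auto simp: controlled_def)
  then have 3: "finite T'" "T' \<subseteq> T0" "C' \<ge> 0" by (auto simp: controlled_by_def)
  have "\<forall>q\<in>insert p B. controlled_by (max s s') (T \<union> T') (max C C') (g q)"
    using 1 2 3 by (auto intro: controlled_by_mono)
  then show ?case using 1 3 by (intro exI[of _ "max s s'"] exI[of _ "T \<union> T'"] exI[of _ "max C C'"]) auto
qed

text \<open>Each entry is a finite linear combination of the coefficient functions; this makes
  \<open>uniq\<close> applicable to the coefficients of the remainder.\<close>

lemma triangular_solution_in: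
  assumes c': "\<And>n. c' n \<in> E"
  shows "(\<lambda>x. triangular_solution K (\<lambda>n. c' n x) n) \<in> E"
proof (induction n rule: less_induct)
  case (less n)
  have "(\<lambda>x. c' n x - (\<Sum>m\<in>M. K m n * triangular_solution K (\<lambda>n. c' n x) m)) \<in> E"
    if "finite M" "M \<subseteq> {..<n}" for M
    using that
  proof (induction rule: finite_induct)
    case empty then show ?case using c' by simp
  next
    case (insert m M)
    then have "(\<lambda>x. (c' n x - (\<Sum>m\<in>M. K m n * triangular_solution K (\<lambda>n. c' n x) m))
        - K m n * triangular_solution K (\<lambda>n. c' n x) m) \<in> E"
      using less by (intro lin) auto
    then show ?case using insert by (simp add: algebra_simps)
  qed
  then show ?case by (subst triangular_solution.simps) auto
qed

end

context controlled_series
begin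

text \<open>
  \<open>L\<close> is the set of leading indices of the ideal of controlled series. For \<open>n \<in> L\<close> the value \<open>H n\<close>
  is a coefficient of the quotient by \<open>g (\<beta> n)\<close>, for \<open>n \<notin> L\<close> one of the remainder.
\<close>

theorem finite_determination:
  "\<exists>s T C. s \<ge> s0 \<and> finite T \<and> T \<subseteq> T0 \<and> C \<ge> 0 \<and>
     (\<forall>\<psi>\<in>characters S s. \<forall>x\<in>D. norm (G \<psi> x) \<le> C * (\<Sum>\<tau>\<in>T. norm (G \<psi> \<tau>)))"
proof -
  define L where "L = {n \<in> S. \<exists>f. controlled f \<and> f n \<noteq> 0 \<and> (\<forall>k\<in>S. k < n \<longrightarrow> f k = 0)}"
  have "\<exists>g. controlled g \<and> g n = 1 \<and> (\<forall>k\<in>S. k < n \<longrightarrow> g k = 0)" if "n \<in> L" for n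
  proof -
    obtain f where f: "controlled f" "f n \<noteq> 0" "\<forall>k\<in>S. k < n \<longrightarrow> f k = 0"
      using \<open>n \<in> L\<close> by (auto simp: L_def)
    then show ?thesis by (intro exI[of _ "\<lambda>k. inverse (f n) * f k"]) (auto intro: controlled_scale)
  qed
  then obtain g where g: "\<And>n. n \<in> L \<Longrightarrow> controlled (g n)" "\<And>n. n \<in> L \<Longrightarrow> g n n = 1"
      "\<And>n k. n \<in> L \<Longrightarrow> k \<in> S \<Longrightarrow> k < n \<Longrightarrow> g n k = 0"
    by metis
  have "L \<subseteq> S" by (auto simp: L_def)
  from dickson[OF this] obtain B where B: "finite B" "B \<subseteq> L" "\<forall>a\<in>L. \<exists>p\<in>B. p dvd a" by auto
  then obtain \<beta> where \<beta>: "\<And>m. m \<in> L \<Longrightarrow> \<beta> m \<in> B" "\<And>m. m \<in> L \<Longrightarrow> \<beta> m dvd m" by metis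
  obtain s1 T C1 where T: "finite T" "T \<subseteq> T0" "C1 \<ge> 0" and ctrl1: "\<And>p. p \<in> B \<Longrightarrow> controlled_by s1 T C1 (g p)"
    using controlled_uniform[of B g] B g(1) by blast
  have "\<exists>s'\<ge>s1. \<forall>s\<ge>s'. \<forall>F. finite F \<longrightarrow> F \<subseteq> S \<inter> {p<..} \<longrightarrow> (\<Sum>d\<in>F. norm (g p d) * (real p / real d) ^ s) \<le> 1/2"
    if "p \<in> B" for p
    by (rule tail_weight_small) (use ctrl1[OF that] that B \<open>L \<subseteq> S\<close> pos in \<open>auto simp: controlled_by_def\<close>)
  then obtain \<sigma> where \<sigma>: "\<And>p s F. p \<in> B \<Longrightarrow> s \<ge> \<sigma> p \<Longrightarrow> finite F \<Longrightarrow> F \<subseteq> S \<inter> {p<..} \<Longrightarrow>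
      (\<Sum>d\<in>F. norm (g p d) * (real p / real d) ^ s) \<le> 1/2"
    by metis
  \<comment> \<open>Besides summability, \<open>s\<close> ensures that the tail of every
    \<open>g p\<close>, weighted relative to its leading index \<open>p\<close>, is at most 1/2. One
    \<open>s\<close> suffices because \<open>B\<close> is finite.\<close>
  define s where "s = Max (insert (max s0 s1) (\<sigma> ` B))"
  have s: "s \<ge> s0" "s \<ge> s1" "\<And>p. p \<in> B \<Longrightarrow> s \<ge> \<sigma> p"
  proof -
    have "x \<le> s" if "x \<in> insert (max s0 s1) (\<sigma> ` B)" for x
      unfolding s_def using that B by (intro Max_ge) auto
    then show "s \<ge> s0" "s \<ge> s1" "\<And>p. p \<in> B \<Longrightarrow> s \<ge> \<sigma> p" by force+
  qed
  have ctrl: "controlled_by s T C1 (g p)" if "p \<in> B" for p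
    using controlled_by_mono[OF ctrl1[OF that] s(2)] T by auto
  define q where "q m = m div \<beta> m" for m
  have q: "m = q m * \<beta> m" "q m \<in> S" "\<beta> m \<in> S" "q m > 0" "\<beta> m > 0" if "m \<in> L" for m
  proof -
    show 1: "m = q m * \<beta> m" using \<beta>(2)[OF that] unfolding q_def by simp
    have "m \<in> S" using that by (auto simp: L_def)
    then show "q m \<in> S" "\<beta> m \<in> S" using mult_iff 1 by metis+
    then show "q m > 0" "\<beta> m > 0" using pos by auto
  qed
  \<comment> \<open>Column \<open>m\<close> lists the coefficients of the monomial of index
    \<open>q m\<close> times \<open>g (\<beta> m)\<close>, the multiple of a basis element whose
    leading index is exactly \<open>m\<close>; its diagonal entry is 1.\<close>
  define K where "K m n = (if m \<in> L \<and> n \<in> S \<and> q m dvd n then g (\<beta> m) (n div q m) else 0)" for m n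
  \<comment> \<open>The recursion runs through all smaller naturals, so the data are extended by
    zero from \<open>S\<close>.\<close>
  define c' where "c' n x = (if n \<in> S then c n x else 0)" for n x
  define b' where "b' n = (if n \<in> S then b n else 0)" for n
  define H where "H n x = triangular_solution K (\<lambda>n. c' n x) n" for n x
  define hb where "hb = triangular_solution (\<lambda>m n. - norm (K m n)) b'"
  define w where "w n = 1 / real n ^ s" for n
  have w_mult: "w (m * n) = w m * w n" for m n by (simp add: w_def power_mult_distrib)
  have w_nonneg: "w n \<ge> 0" for n by (simp add: w_def)
  have H_le: "norm (H n x) \<le> hb n" if "x \<in> D" for n x
    unfolding H_def hb_def by (rule norm_triangular_solution_le) (use c_le that in \<open>auto simp: c'_def b'_def\<close>)
  have "norm (triangular_solution K (\<lambda>_. 0) n) \<le> hb n" for n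
    unfolding hb_def by (rule norm_triangular_solution_le) (use b_nonneg in \<open>auto simp: b'_def\<close>)
  then have hb_nonneg: "hb n \<ge> 0" for n using norm_ge_zero order_trans by blast
  have c'_in: "c' n \<in> E" for n
    using c_in[of n] lin[OF c_in[of n] c_in[of n], of 1] unfolding c'_def by (cases "n \<in> S") auto
  have H_in: "H n \<in> E" for n
    unfolding H_def[abs_def] by (rule triangular_solution_in) (use c'_in in auto)
  \<comment> \<open>Writing \<open>n = q m * d\<close> turns the column sum into the tail of
    \<open>g (\<beta> m)\<close> beyond its leading index \<open>\<beta> m\<close>, scaled by
    \<open>w m\<close>.\<close>
  have col: "(\<Sum>n\<in>{m<..<X}. norm (K m n) * w n) \<le> w m / 2" for m X
  proof (cases "m \<in> L")
    case False
    then show ?thesis by (simp add: K_def w_nonneg)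
  next
    case True
    note qm = q[OF True]
    define F where "F = {d \<in> S. \<beta> m < d \<and> q m * d < X}"
    have "F \<subseteq> {..X}"
    proof
      fix d assume "d \<in> F"
      then have "q m * d < X" by (simp add: F_def)
      with qm(4) have "d < X" using le_less_trans[of d "q m * d" X] by simp
      then show "d \<in> {..X}" by simp
    qed
    then have F: "finite F" "F \<subseteq> S \<inter> {\<beta> m<..}" using finite_subset by (auto simp: F_def)
    have "(\<Sum>n\<in>{m<..<X}. norm (K m n) * w n) = (\<Sum>n\<in>(\<lambda>d. q m * d) ` F. norm (K m n) * w n)"
    proof (rule sum.mono_neutral_right)
      show "(\<lambda>d. q m * d) ` F \<subseteq> {m<..<X}"
        using qm(4) by (subst qm(1)) (auto simp: F_def)
      show "\<forall>i\<in>{m<..<X} - (\<lambda>d. q m * d) ` F. norm (K m i) * w i = 0"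
      proof
        fix i assume i: "i \<in> {m<..<X} - (\<lambda>d. q m * d) ` F"
        have False if di: "q m dvd i" and iS: "i \<in> S"
        proof -
          obtain d where d: "i = q m * d" using di by auto
          have "d \<in> S" using iS d mult_iff by auto
          moreover have "\<beta> m < d"
          proof -
            have "q m * \<beta> m < q m * d" using i d qm(1) by auto
            then show ?thesis by simp
          qed
          ultimately have "d \<in> F" using i d by (auto simp: F_def)
          then show False using i d by auto
        qed
        then show "norm (K m i) * w i = 0" by (auto simp: K_def)
      qed
    qed auto
    also have "\<dots> = (\<Sum>d\<in>F. norm (K m (q m * d)) * w (q m * d))"
      using qm(4) by (subst sum.reindex) (auto simp: inj_on_def)
    also have "\<dots> = (\<Sum>d\<in>F. w m * (norm (g (\<beta> m) d) * (real (\<beta> m) / real d) ^ s))"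
    proof (rule sum.cong)
      fix d assume "d \<in> F"
      then have dS: "d \<in> S" by (simp add: F_def)
      have "w m = w (q m) * w (\<beta> m)" using w_mult qm(1) by metis
      then have "w m * (real (\<beta> m) / real d) ^ s = w (q m * d)"
        using qm(5) by (simp add: w_mult) (simp add: w_def power_divide)
      moreover have "K m (q m * d) = g (\<beta> m) d"
        using True qm dS mult_iff unfolding K_def by simp
      ultimately show "norm (K m (q m * d)) * w (q m * d) = w m * (norm (g (\<beta> m) d) * (real (\<beta> m) / real d) ^ s)"
        by (simp add: mult_ac)
    qed simp
    also have "\<dots> = w m * (\<Sum>d\<in>F. norm (g (\<beta> m) d) * (real (\<beta> m) / real d) ^ s)"
      by (simp add: sum_distrib_left)
    also have "\<dots> \<le> w m * (1/2)"
      using \<sigma>[OF \<beta>(1)[OF True] s(3)[OF \<beta>(1)[OF True]] F] by (intro mult_left_mono w_nonneg)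
    finally show ?thesis by simp
  qed
  have b_sm: "(\<lambda>n. b n / real n ^ s) summable_on S"
    by (rule weight_summable_mono[OF b_summable s(1)]) (rule b_nonneg)
  define Z where "Z = (\<Sum>\<^sub>\<infinity>n\<in>S. b n / real n ^ s)"
  have hb_partial: "(\<Sum>n<X. hb n * w n) \<le> 2 * Z" for X
  proof -
    have "(\<Sum>n<X. hb n * w n) \<le> 2 * (\<Sum>n<X. b' n * w n)"
      unfolding hb_def by (rule triangular_solution_weighted_sum_le) (use w_nonneg b_nonneg col in \<open>auto simp: b'_def\<close>)
    also have "(\<Sum>n<X. b' n * w n) = (\<Sum>n\<in>{..<X} \<inter> S. b n / real n ^ s)"
      by (subst sum.inter_restrict) (auto intro!: sum.cong simp: b'_def w_def)
    also have "\<dots> \<le> Z" unfolding Z_def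
      by (intro finite_sum_le_infsum b_sm) (auto intro!: b_nonneg divide_nonneg_nonneg)
    finally show ?thesis by simp
  qed
  have hb_sm: "(\<lambda>n. hb n * w n) summable_on UNIV"
  proof (rule nonneg_bdd_above_summable_on)
    show "bdd_above (sum (\<lambda>n. hb n * w n) ` {F. F \<subseteq> UNIV \<and> finite F})"
    proof (rule bdd_aboveI2)
      fix F :: "nat set" assume "F \<in> {F. F \<subseteq> UNIV \<and> finite F}"
      then obtain X where "F \<subseteq> {..<X}" using finite_nat_iff_bounded by auto
      then have "(\<Sum>n\<in>F. hb n * w n) \<le> (\<Sum>n<X. hb n * w n)"
        by (intro sum_mono2) (auto intro!: mult_nonneg_nonneg hb_nonneg w_nonneg)
      also have "\<dots> \<le> 2 * Z" by (rule hb_partial)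
      finally show "(\<Sum>n\<in>F. hb n * w n) \<le> 2 * Z" .
    qed
  qed (auto intro!: mult_nonneg_nonneg hb_nonneg w_nonneg)
  then have hb_sm': "(\<lambda>n. hb n * w n) summable_on M" for M
    using summable_on_subset_banach by blast
  define r where "r x n = (if n \<in> L then 0 else H n x)" for x n
  have r_sm: "(\<lambda>n. norm (r x n) / real n ^ s) summable_on S" if "x \<in> D" for x
  proof (rule summable_on_comparison_test[OF hb_sm'])
    fix n
    show "norm (r x n) / real n ^ s \<le> hb n * w n"
      using H_le[OF that, of n] hb_nonneg[of n] by (auto simp: r_def w_def intro!: divide_right_mono)
  qed auto
  \<comment> \<open>The coefficient of index \<open>n\<close> in the division identity. Columns with
    \<open>m > n\<close> vanish there because \<open>g (\<beta> m)\<close> has no coefficient below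
    \<open>\<beta> m\<close>, so the sum over \<open>L\<close> is finite and raises no question of
    convergence.\<close>
  have pointwise: "((\<lambda>m. K m n * H m x) has_sum (c n x - r x n)) L" if n: "n \<in> S" for n x
  proof -
    have "c n x - r x n = (\<Sum>m\<in>L \<inter> {..n}. K m n * H m x)"
    proof -
      have "H n x = c n x - (\<Sum>m<n. K m n * H m x)"
        unfolding H_def by (subst triangular_solution.simps) (use n in \<open>auto simp: c'_def\<close>)
      also have "(\<Sum>m<n. K m n * H m x) = (\<Sum>m\<in>L \<inter> {..<n}. K m n * H m x)"
        by (rule sum.mono_neutral_right) (auto simp: K_def)
      finally have 1: "c n x = H n x + (\<Sum>m\<in>L \<inter> {..<n}. K m n * H m x)" by simp
      show ?thesis
      proof (cases "n \<in> L")
        case True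
        have "K n n = g (\<beta> n) (n div q n)" using True n q(1)[OF True] by (simp add: K_def dvd_def) metis
        also have "n div q n = \<beta> n" using q[OF True] by (metis nonzero_mult_div_cancel_left less_numeral_extra(3))
        finally have "K n n = 1" using g(2) \<beta>(1)[OF True] B by auto
        moreover have "L \<inter> {..n} = insert n (L \<inter> {..<n})" using True by auto
        ultimately show ?thesis using 1 True by (simp add: r_def)
      next
        case False
        then have "L \<inter> {..n} = L \<inter> {..<n}" by (auto simp: order_le_less)
        then show ?thesis using 1 False by (simp add: r_def)
      qed
    qed
    moreover have "((\<lambda>m. K m n * H m x) has_sum (\<Sum>m\<in>L \<inter> {..n}. K m n * H m x)) L"
    proof (rule has_sum_finite_neutralI)
      fix m assume m: "m \<in> L - L \<inter> {..n}"
      then have mL: "m \<in> L" and nm: "n < m" by auto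
      have "K m n = 0" if dv: "q m dvd n"
      proof -
        obtain d where d: "n = q m * d" using dv by auto
        have "q m * d < q m * \<beta> m" using nm q(1)[OF mL] d by simp
        then have "d < \<beta> m" by simp
        moreover have "d \<in> S" using n d mult_iff by auto
        ultimately have "g (\<beta> m) d = 0" using g(3) \<beta>(1)[OF mL] B by blast
        then show ?thesis using d q(4)[OF mL] by (simp add: K_def)
      qed
      then show "K m n * H m x = 0" by (auto simp: K_def)
    qed auto
    ultimately show ?thesis by simp
  qed
  define N where "N p = (\<Sum>\<^sub>\<infinity>d\<in>S. norm (g p d) / real d ^ s)" for p
  define A where "A = (\<Sum>p\<in>B. real p ^ s)"
  define A' where "A' = (\<Sum>p\<in>B. real p ^ s * N p)"
  have N_nonneg: "N p \<ge> 0" for p unfolding N_def by (intro infsum_nonneg) auto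
  \<comment> \<open>Dividing off \<open>\<beta> m\<close> enlarges the weight by
    \<open>\<beta> m ^ s\<close>; since \<open>\<beta> m\<close> lies in the finite set
    \<open>B\<close>, the loss is bounded.\<close>
  have wq: "w (q m) = w m * real (\<beta> m) ^ s" if "m \<in> L" for m
  proof -
    have "w m = w (q m) * w (\<beta> m)" using w_mult q(1)[OF that] by metis
    then show ?thesis using q(5)[OF that] by (simp add: w_def)
  qed
  have wqA: "w (q m) \<le> w m * A" if "m \<in> L" for m
    unfolding wq[OF that] A_def using B \<beta>(1)[OF that]
    by (intro mult_left_mono member_le_sum w_nonneg) auto
  have wqA': "w (q m) * N (\<beta> m) \<le> w m * A'" if "m \<in> L" for m
    unfolding wq[OF that] A'_def mult.assoc using B \<beta>(1)[OF that]
    by (intro mult_left_mono member_le_sum w_nonneg) (auto intro!: mult_nonneg_nonneg N_nonneg)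
  \<comment> \<open>Summed along a column, the double series factors into the quotient coefficient,
    \<open>\<psi> (q m)\<close> and the value of a basis element, by multiplicativity of
    \<open>\<psi>\<close>. Summed along a row it gives \<open>c n x - r x n\<close>. Absolute
    summability permits the exchange.\<close>
  have identity: "((\<lambda>m. H m x * \<psi> (q m) * ev \<psi> (g (\<beta> m))) has_sum (G \<psi> x - ev \<psi> (r x))) L"
    if x: "x \<in> D" and \<psi>: "\<psi> \<in> characters S s" for x \<psi>
  proof -
    have column: "((\<lambda>n. \<psi> n * K m n * H m x) has_sum H m x * \<psi> (q m) * ev \<psi> (g (\<beta> m))) S"
      if m: "m \<in> L" for m
    proof -
      have "(\<lambda>d. \<psi> d * g (\<beta> m) d) summable_on S"
        by (rule character_series(1)[OF \<psi> order_refl])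
           (use ctrl[OF \<beta>(1)[OF m]] in \<open>auto simp: controlled_by_def\<close>)
      then have "((\<lambda>d. \<psi> (q m) * (\<psi> d * g (\<beta> m) d) * H m x) has_sum (\<psi> (q m) * ev \<psi> (g (\<beta> m)) * H m x)) S"
        unfolding ev_def by (intro has_sum_cmult_left has_sum_cmult_right has_sum_infsum)
      also have "?this \<longleftrightarrow> ((\<lambda>d. \<psi> (q m * d) * K m (q m * d) * H m x) has_sum (\<psi> (q m) * ev \<psi> (g (\<beta> m)) * H m x)) S"
        by (rule has_sum_cong) (use \<psi> m q[OF m] mult_iff in \<open>auto simp: K_def characters_def\<close>)
      also have "\<dots> \<longleftrightarrow> ((\<lambda>n. if q m dvd n then \<psi> n * K m n * H m x else 0) has_sum (\<psi> (q m) * ev \<psi> (g (\<beta> m)) * H m x)) S"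
        by (rule has_sum_multiples[symmetric]) (use mult_iff q[OF m] in auto)
      also have "\<dots> \<longleftrightarrow> ((\<lambda>n. \<psi> n * K m n * H m x) has_sum (\<psi> (q m) * ev \<psi> (g (\<beta> m)) * H m x)) S"
        by (rule has_sum_cong_neutral) (auto simp: K_def)
      finally show ?thesis by (simp add: mult_ac)
    qed
    have sm: "(\<lambda>(m, n). \<psi> n * K m n * H m x) summable_on (L \<times> S)"
    proof (rule summable_on_double_series)
      show "norm (\<psi> n * K m n * H m x) \<le> w n * norm (K m n) * hb m" if "m \<in> L" "n \<in> S" for m n
        unfolding norm_mult using \<psi> that H_le[OF x] w_nonneg
        by (intro mult_mono) (auto simp: characters_def w_def)
      show "((\<lambda>n. w n * norm (K m n) * hb m) has_sum hb m * (w (q m) * N (\<beta> m))) S" if m: "m \<in> L" for m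
      proof -
        have "((\<lambda>d. w (q m) * (norm (g (\<beta> m) d) / real d ^ s) * hb m) has_sum (w (q m) * N (\<beta> m) * hb m)) S"
          unfolding N_def using ctrl[OF \<beta>(1)[OF m]]
          by (intro has_sum_cmult_left has_sum_cmult_right has_sum_infsum) (auto simp: controlled_by_def)
        also have "?this \<longleftrightarrow> ((\<lambda>d. w (q m * d) * norm (K m (q m * d)) * hb m) has_sum (w (q m) * N (\<beta> m) * hb m)) S"
          by (rule has_sum_cong) (use m q[OF m] mult_iff in \<open>auto simp: K_def w_def power_mult_distrib\<close>)
        also have "\<dots> \<longleftrightarrow> ((\<lambda>n. if q m dvd n then w n * norm (K m n) * hb m else 0) has_sum (w (q m) * N (\<beta> m) * hb m)) S"
          by (rule has_sum_multiples[symmetric]) (use mult_iff q[OF m] in auto)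
        also have "\<dots> \<longleftrightarrow> ((\<lambda>n. w n * norm (K m n) * hb m) has_sum (w (q m) * N (\<beta> m) * hb m)) S"
          by (rule has_sum_cong_neutral) (auto simp: K_def)
        finally show ?thesis by (simp add: mult_ac)
      qed
      show "(\<lambda>m. hb m * (w (q m) * N (\<beta> m))) summable_on L"
      proof (rule summable_on_comparison_test)
        show "(\<lambda>m. hb m * w m * A') summable_on L" by (intro summable_on_cmult_left hb_sm')
        show "hb m * (w (q m) * N (\<beta> m)) \<le> hb m * w m * A'" if "m \<in> L" for m
          unfolding mult.assoc by (intro mult_left_mono wqA' that hb_nonneg)
      qed (auto intro!: mult_nonneg_nonneg hb_nonneg w_nonneg N_nonneg)
    qed
    have sm': "(\<lambda>p. case p of (n, m) \<Rightarrow> \<psi> n * K m n * H m x) summable_on (S \<times> L)"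
      using sm by (subst summable_on_swap) (simp add: case_prod_unfold)
    have row: "((\<lambda>m. \<psi> n * K m n * H m x) has_sum \<psi> n * (c n x - r x n)) L" if "n \<in> S" for n
      using has_sum_cmult_right[OF pointwise[OF that, of x], of "\<psi> n"] by (simp add: mult_ac)
    have "((\<lambda>n. \<psi> n * c n x + - (\<psi> n * r x n)) has_sum (G \<psi> x + - ev \<psi> (r x))) S"
      unfolding G_def ev_def
      by (intro has_sum_add has_sum_uminusI has_sum_infsum character_series(1)[OF \<psi> c_le b_sm]
            character_series(1)[OF \<psi> order_refl] r_sm x)
    then have "((\<lambda>p. case p of (n, m) \<Rightarrow> \<psi> n * K m n * H m x) has_sum (G \<psi> x - ev \<psi> (r x))) (S \<times> L)"
      using row sm' by (intro has_sum_SigmaI) (auto simp: algebra_simps)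
    then have "((\<lambda>(m, n). \<psi> n * K m n * H m x) has_sum (G \<psi> x - ev \<psi> (r x))) (L \<times> S)"
      by (subst has_sum_swap) (simp add: case_prod_unfold)
    then show ?thesis by (rule has_sum_SigmaD) (use column in auto)
  qed
  define C2 where "C2 = (\<Sum>\<^sub>\<infinity>m\<in>L. hb m * w m) * A * C1"
  have A0: "A \<ge> 0" unfolding A_def by (intro sum_nonneg) auto
  then have C2: "C2 \<ge> 0" unfolding C2_def using T
    by (intro mult_nonneg_nonneg infsum_nonneg) (auto intro: hb_nonneg w_nonneg)
  have diff_le: "norm (G \<psi> x - ev \<psi> (r x)) \<le> C2 * (\<Sum>\<tau>\<in>T. norm (G \<psi> \<tau>))"
    if x: "x \<in> D" and \<psi>: "\<psi> \<in> characters S s" for x \<psi>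
  proof (rule norm_infsum_le[OF identity[OF x \<psi>]])
    let ?\<Sigma> = "\<Sum>\<tau>\<in>T. norm (G \<psi> \<tau>)"
    have "((\<lambda>m. (hb m * w m) * (A * (C1 * ?\<Sigma>))) has_sum ((\<Sum>\<^sub>\<infinity>m\<in>L. hb m * w m) * (A * (C1 * ?\<Sigma>)))) L"
      by (intro has_sum_cmult_left has_sum_infsum hb_sm')
    then show "((\<lambda>m. hb m * (w m * A) * (C1 * ?\<Sigma>)) has_sum (C2 * ?\<Sigma>)) L"
      by (simp add: C2_def mult_ac)
    fix m assume m: "m \<in> L"
    have "norm (\<psi> (q m)) \<le> w (q m)" using \<psi> q(2)[OF m] by (auto simp: characters_def w_def)
    also have "\<dots> \<le> w m * A" by (rule wqA[OF m])
    finally have 1: "norm (\<psi> (q m)) \<le> w m * A" .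
    have "norm (ev \<psi> (g (\<beta> m))) \<le> C1 * ?\<Sigma>"
      using ctrl[OF \<beta>(1)[OF m]] \<psi> by (auto simp: controlled_by_def)
    with 1 show "norm (H m x * \<psi> (q m) * ev \<psi> (g (\<beta> m))) \<le> hb m * (w m * A) * (C1 * ?\<Sigma>)"
      unfolding norm_mult using H_le[OF x] A0 hb_nonneg w_nonneg by (intro mult_mono) auto
  qed
  \<comment> \<open>For \<open>x\<close> in \<open>T0\<close>, \<open>diff_le\<close> bounds the
    remainder by the values of \<open>G\<close> at \<open>T\<close> and at \<open>x\<close>, so
    \<open>r x\<close> is controlled. If it were nonzero, its least index would belong to
    \<open>L\<close>, where \<open>r\<close> is zero by definition.\<close>
  have r0: "r x n = 0" if x: "x \<in> T0" and n: "n \<in> S" for x n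
  proof (rule ccontr)
    assume "r x n \<noteq> 0"
    define n0 where "n0 = (LEAST n. n \<in> S \<and> r x n \<noteq> 0)"
    have n0: "n0 \<in> S" "r x n0 \<noteq> 0" using LeastI[of "\<lambda>n. n \<in> S \<and> r x n \<noteq> 0" n] n \<open>r x n \<noteq> 0\<close>
      by (auto simp: n0_def)
    have n0': "r x k = 0" if "k \<in> S" "k < n0" for k
      using not_less_Least[of k "\<lambda>n. n \<in> S \<and> r x n \<noteq> 0"] that by (auto simp: n0_def)
    have xD: "x \<in> D" using x T0 by auto
    have "controlled_by s (insert x T) (1 + C2) (r x)"
      unfolding controlled_by_def
    proof (intro conjI ballI)
      show "(\<lambda>n. norm (r x n) / real n ^ s) summable_on S" by (rule r_sm[OF xD])
      fix \<psi> assume \<psi>: "\<psi> \<in> characters S s"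
      let ?\<Sigma> = "\<Sum>\<tau>\<in>insert x T. norm (G \<psi> \<tau>)"
      have "norm (ev \<psi> (r x)) \<le> norm (G \<psi> x) + norm (G \<psi> x - ev \<psi> (r x))"
        by (metis norm_minus_commute norm_triangle_sub)
      also have "\<dots> \<le> norm (G \<psi> x) + C2 * (\<Sum>\<tau>\<in>T. norm (G \<psi> \<tau>))"
        using diff_le[OF xD \<psi>] by simp
      also have "\<dots> \<le> ?\<Sigma> + C2 * ?\<Sigma>"
        using T C2 by (intro add_mono mult_left_mono sum_mono2 member_le_sum) auto
      finally show "norm (ev \<psi> (r x)) \<le> (1 + C2) * ?\<Sigma>" by (simp add: algebra_simps)
    qed (use T x C2 in auto)
    then have "n0 \<in> L" using n0 n0' by (auto simp: L_def controlled_def)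
    then show False using n0 by (simp add: r_def)
  qed
  \<comment> \<open>Outside \<open>L\<close> the coefficient is a member of \<open>E\<close> that
    vanishes on \<open>T0\<close>, so it vanishes on all of \<open>D\<close>.\<close>
  have r0': "r x n = 0" if x: "x \<in> D" and n: "n \<in> S" for x n
  proof (cases "n \<in> L")
    case False
    then have "H n t = 0" if "t \<in> T0" for t using r0[OF that n] by (simp add: r_def)
    from uniq[OF H_in this x] show ?thesis by (simp add: r_def)
  qed (simp add: r_def)
  show ?thesis
  proof (intro exI[of _ s] exI[of _ T] exI[of _ C2] conjI ballI)
    fix \<psi> x assume "\<psi> \<in> characters S s" "x \<in> D"
    moreover have "ev \<psi> (r x) = 0" unfolding ev_def by (rule infsum_0) (use r0'[OF \<open>x \<in> D\<close>] in auto)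
    ultimately show "norm (G \<psi> x) \<le> C2 * (\<Sum>\<tau>\<in>T. norm (G \<psi> \<tau>))" using diff_le[of x \<psi>] by simp
  qed (use T s C2 in auto)
qed

end

section \<open>Power series in the parameters\<close>

lemma holomorphic_on_infsum:
  fixes f :: "'a \<Rightarrow> complex \<Rightarrow> complex"
  assumes "open A" and hol: "\<And>i. i \<in> I \<Longrightarrow> f i holomorphic_on A"
    and le: "\<And>i z. i \<in> I \<Longrightarrow> z \<in> A \<Longrightarrow> norm (f i z) \<le> M i" and sm: "M summable_on I"
  shows "(\<lambda>z. \<Sum>\<^sub>\<infinity>i\<in>I. f i z) holomorphic_on A"
  unfolding holomorphic_on_def
proof
  fix z assume "z \<in> A"
  then obtain r where r: "r > 0" "cball z r \<subseteq> A" using \<open>open A\<close> open_contains_cball by blast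
  have sub: "ball z r \<subseteq> A" using r ball_subset_cball by blast
  have "(\<lambda>z. \<Sum>\<^sub>\<infinity>i\<in>I. f i z) holomorphic_on ball z r"
  proof (rule holomorphic_uniform_limit)
    show "uniform_limit (cball z r) (\<lambda>X z. \<Sum>i\<in>X. f i z) (\<lambda>z. \<Sum>\<^sub>\<infinity>i\<in>I. f i z) (finite_subsets_at_top I)"
      by (rule Weierstrass_m_test_general[OF le sm]) (use r in auto)
    show "eventually (\<lambda>X. continuous_on (cball z r) (\<lambda>z. \<Sum>i\<in>X. f i z) \<and> (\<lambda>z. \<Sum>i\<in>X. f i z) holomorphic_on ball z r)
        (finite_subsets_at_top I)"
      by (rule eventually_finite_subsets_at_top_weakI)
         (intro conjI continuous_on_sum holomorphic_on_sum
            continuous_on_subset[OF holomorphic_on_imp_continuous_on[OF hol] r(2)]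
            holomorphic_on_subset[OF hol sub]; blast)
  qed auto
  then have "(\<lambda>z. \<Sum>\<^sub>\<infinity>i\<in>I. f i z) field_differentiable at z"
    using r by (intro holomorphic_on_imp_differentiable_at[of _ "ball z r"]) auto
  then show "(\<lambda>z. \<Sum>\<^sub>\<infinity>i\<in>I. f i z) field_differentiable at z within A"
    by (rule field_differentiable_at_within)
qed

definition monomial :: "nat set \<Rightarrow> (nat \<Rightarrow> complex) \<Rightarrow> nat \<Rightarrow> complex" where
  "monomial P \<nu> n = (\<Prod>p\<in>P. \<nu> p ^ multiplicity p n)"

definition small_params :: "nat set \<Rightarrow> nat \<Rightarrow> (nat \<Rightarrow> complex) set" where
  "small_params P s = {\<nu>. \<forall>p\<in>P. norm (\<nu> p) \<le> 1 / real p ^ s}"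

lemma monomial_mult:
  assumes "\<And>p. p \<in> P \<Longrightarrow> prime p" "m > 0" "n > 0"
  shows "monomial P \<nu> (m * n) = monomial P \<nu> m * monomial P \<nu> n"
  unfolding monomial_def prod.distrib[symmetric]
  by (rule prod.cong) (use assms in \<open>auto simp: prime_elem_multiplicity_mult_distrib power_add\<close>)

lemma monomial_prime:
  assumes "\<And>p. p \<in> P \<Longrightarrow> prime p" "finite P" "p \<in> P"
  shows "monomial P \<nu> p = \<nu> p"
proof -
  have "monomial P \<nu> p = (\<Prod>q\<in>P. if q = p then \<nu> p else 1)"
    unfolding monomial_def
    by (rule prod.cong) (use assms in \<open>auto simp: prime_multiplicity_other\<close>)
  then show ?thesis using assms by simp
qed

lemma smooth_number_as_product:
  assumes P: "\<And>p. p \<in> P \<Longrightarrow> prime p" and "finite P" "n \<in> smooth_numbers P"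
  shows "n = (\<Prod>p\<in>P. p ^ multiplicity p n)"
proof -
  have n: "n > 0" "prime_factors n \<subseteq> P" using assms by (auto simp: smooth_numbers_def)
  then have "n = (\<Prod>p\<in>prime_factors n. p ^ multiplicity p n)"
    using prime_factorization_nat by blast
  also have "\<dots> = (\<Prod>p\<in>P. p ^ multiplicity p n)"
  proof (rule prod.mono_neutral_left)
    show "\<forall>p\<in>P - prime_factors n. p ^ multiplicity p n = 1"
      using n P by (auto simp: in_prime_factors_iff not_dvd_imp_multiplicity_0)
  qed (use assms n in auto)
  finally show ?thesis .
qed

lemma monomial_in_characters:
  assumes P: "\<And>p. p \<in> P \<Longrightarrow> prime p" "finite P" and \<nu>: "\<nu> \<in> small_params P s"
  shows "monomial P \<nu> \<in> characters (smooth_numbers P) s"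
proof -
  have "norm (monomial P \<nu> n) \<le> 1 / real n ^ s" if n: "n \<in> smooth_numbers P" for n
  proof -
    have "norm (monomial P \<nu> n) = (\<Prod>p\<in>P. norm (\<nu> p) ^ multiplicity p n)"
      unfolding monomial_def by (simp add: prod_norm[symmetric] norm_power)
    also have "\<dots> \<le> (\<Prod>p\<in>P. (1 / real p ^ s) ^ multiplicity p n)"
      using \<nu> by (intro prod_mono) (auto simp: small_params_def intro!: power_mono)
    also have "\<dots> = 1 / (\<Prod>p\<in>P. real p ^ multiplicity p n) ^ s"
    proof -
      have "(1 / real p ^ s) ^ k = 1 / (real p ^ k) ^ s" for p k
        by (simp add: power_one_over power_mult[symmetric] mult.commute)
      then show ?thesis by (simp add: prod_dividef prod_power_distrib)
    qed
    also have "(\<Prod>p\<in>P. real p ^ multiplicity p n) = real n"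
      using arg_cong[OF smooth_number_as_product[OF P n], of real] by simp
    finally show ?thesis .
  qed
  then show ?thesis using monomial_mult[OF P(1)] smooth_numbers_pos
    by (auto simp: characters_def)
qed

text \<open>\<open>B\<close> is a majorant norm: the series of sup bounds at the corner of the
  polydisc with radii \<open>1 / p ^ s\<close>. Tracking it as a number reduces infinite sums of
  such series to sums of reals.\<close>

definition series_data ::
    "nat set \<Rightarrow> nat \<Rightarrow> (nat \<Rightarrow> complex \<Rightarrow> complex) \<Rightarrow> (nat \<Rightarrow> real) \<Rightarrow> real \<Rightarrow> ((nat \<Rightarrow> complex) \<Rightarrow> complex \<Rightarrow> complex) \<Rightarrow> bool" where
  "series_data P s c b B G \<longleftrightarrow> (\<forall>n. c n holomorphic_on ball 0 5) \<and> (\<forall>n. b n \<ge> 0) \<and>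
     (\<forall>n. \<forall>t\<in>ball 0 5. norm (c n t) \<le> b n) \<and>
     ((\<lambda>n. b n / real n ^ s) has_sum B) (smooth_numbers P) \<and>
     (\<forall>\<nu>\<in>small_params P s. \<forall>t\<in>ball 0 5. ((\<lambda>n. monomial P \<nu> n * c n t) has_sum G \<nu> t) (smooth_numbers P))"

definition series_rep :: "nat set \<Rightarrow> nat \<Rightarrow> real \<Rightarrow> ((nat \<Rightarrow> complex) \<Rightarrow> complex \<Rightarrow> complex) \<Rightarrow> bool" where
  "series_rep P s B G \<longleftrightarrow> (\<exists>c b. series_data P s c b B G)"

text \<open>A factor is described by its action on an arbitrary series, with operator bound
  \<open>\<kappa>\<close>. Products of many factors then arise by composition, and no Cauchy product
  of two general series has to be formed.\<close>

definition multiplier :: "nat set \<Rightarrow> nat \<Rightarrow> real \<Rightarrow> ((nat \<Rightarrow> complex) \<Rightarrow> complex \<Rightarrow> complex) \<Rightarrow> bool" where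
  "multiplier P s \<kappa> M \<longleftrightarrow> (\<forall>B G. series_rep P s B G \<longrightarrow> series_rep P s (\<kappa> * B) (\<lambda>\<nu> t. M \<nu> t * G \<nu> t))"

lemma series_repI:
  assumes "\<And>n. c n holomorphic_on ball 0 5" "\<And>n. b n \<ge> 0" "\<And>n t. t \<in> ball 0 5 \<Longrightarrow> norm (c n t) \<le> b n"
     "((\<lambda>n. b n / real n ^ s) has_sum B) (smooth_numbers P)"
     "\<And>\<nu> t. \<nu> \<in> small_params P s \<Longrightarrow> t \<in> ball 0 5 \<Longrightarrow> ((\<lambda>n. monomial P \<nu> n * c n t) has_sum G \<nu> t) (smooth_numbers P)"
  shows "series_rep P s B G"
  unfolding series_rep_def series_data_def using assms by blast

lemma series_dataD:
  assumes "series_data P s c b B G"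
  shows "c n holomorphic_on ball 0 5" "b n \<ge> 0" "t \<in> ball 0 5 \<Longrightarrow> norm (c n t) \<le> b n"
    "((\<lambda>n. b n / real n ^ s) has_sum B) (smooth_numbers P)"
    "\<nu> \<in> small_params P s \<Longrightarrow> t \<in> ball 0 5 \<Longrightarrow> ((\<lambda>n. monomial P \<nu> n * c n t) has_sum G \<nu> t) (smooth_numbers P)"
  using assms unfolding series_data_def by blast+

lemma series_rep_one: "series_rep P s 1 (\<lambda>\<nu> t. 1)"
proof (rule series_repI)
  show "((\<lambda>n. (if n = 1 then 1 else 0) / real n ^ s) has_sum 1) (smooth_numbers P)"
    by (rule has_sum_finite_neutralI[of "{1}"]) (use one_in_smooth_numbers in auto)
  show "((\<lambda>n. monomial P \<nu> n * (if n = 1 then 1 else 0)) has_sum 1) (smooth_numbers P)" for \<nu>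
    by (rule has_sum_finite_neutralI[of "{1}"]) (use one_in_smooth_numbers in \<open>auto simp: monomial_def\<close>)
qed auto

lemma series_rep_norm_le:
  assumes "series_rep P s B G" "\<And>p. p \<in> P \<Longrightarrow> prime p" "finite P" "\<nu> \<in> small_params P s" "t \<in> ball 0 5"
  shows "norm (G \<nu> t) \<le> B"
proof -
  obtain c b where "series_data P s c b B G" using assms(1) unfolding series_rep_def by blast
  note * = series_dataD(2,3,4)[OF this] series_dataD(5)[OF this assms(4,5)]
  have "norm (\<Sum>\<^sub>\<infinity>n\<in>smooth_numbers P. monomial P \<nu> n * c n t) \<le> (\<Sum>\<^sub>\<infinity>n\<in>smooth_numbers P. b n / real n ^ s)"
    using * assms by (intro character_series(2) monomial_in_characters has_sum_imp_summable) auto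
  then show ?thesis using *(3,4) by (simp add: infsumI)
qed

lemma series_rep_add:
  assumes "series_rep P s B1 G1" "series_rep P s B2 G2"
  shows "series_rep P s (B1 + B2) (\<lambda>\<nu> t. G1 \<nu> t + G2 \<nu> t)"
proof -
  obtain c1 b1 where "series_data P s c1 b1 B1 G1" using assms(1) unfolding series_rep_def by blast
  note 1 = series_dataD[OF this]
  obtain c2 b2 where "series_data P s c2 b2 B2 G2" using assms(2) unfolding series_rep_def by blast
  note 2 = series_dataD[OF this]
  show ?thesis
  proof (rule series_repI[of "\<lambda>n t. c1 n t + c2 n t" "\<lambda>n. b1 n + b2 n"])
    show "((\<lambda>n. (b1 n + b2 n) / real n ^ s) has_sum B1 + B2) (smooth_numbers P)"
      using has_sum_add[OF 1(4) 2(4)] by (simp add: add_divide_distrib)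
    show "norm (c1 n t + c2 n t) \<le> b1 n + b2 n" if "t \<in> ball 0 5" for n t
      using norm_triangle_mono[OF 1(3)[OF that] 2(3)[OF that]] .
    show "((\<lambda>n. monomial P \<nu> n * (c1 n t + c2 n t)) has_sum G1 \<nu> t + G2 \<nu> t) (smooth_numbers P)"
      if "\<nu> \<in> small_params P s" "t \<in> ball 0 5" for \<nu> t
      using has_sum_add[OF 1(5)[OF that] 2(5)[OF that]] by (simp add: distrib_left)
  qed (use 1 2 in \<open>auto intro!: holomorphic_intros\<close>)
qed

lemma multiplier_add: "multiplier P s \<kappa>1 M1 \<Longrightarrow> multiplier P s \<kappa>2 M2 \<Longrightarrow> multiplier P s (\<kappa>1 + \<kappa>2) (\<lambda>\<nu> t. M1 \<nu> t + M2 \<nu> t)"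
  unfolding multiplier_def by (auto simp: distrib_right intro: series_rep_add)

lemma multiplier_mult: "multiplier P s \<kappa>1 M1 \<Longrightarrow> multiplier P s \<kappa>2 M2 \<Longrightarrow> multiplier P s (\<kappa>1 * \<kappa>2) (\<lambda>\<nu> t. M1 \<nu> t * M2 \<nu> t)"
  unfolding multiplier_def by (auto simp: mult.assoc)

lemma multiplier_bounded_holomorphic:
  assumes "h holomorphic_on ball 0 5" "\<And>t. t \<in> ball 0 5 \<Longrightarrow> norm (h t) \<le> \<kappa>"
  shows "multiplier P s \<kappa> (\<lambda>\<nu> t. h t)"
  unfolding multiplier_def
proof (intro allI impI)
  fix B G assume "series_rep P s B G"
  then obtain c b where "series_data P s c b B G" unfolding series_rep_def by blast
  note 1 = series_dataD[OF this]
  have \<kappa>: "\<kappa> \<ge> 0" using order_trans[OF norm_ge_zero assms(2)[of 0]] by simp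
  show "series_rep P s (\<kappa> * B) (\<lambda>\<nu> t. h t * G \<nu> t)"
  proof (rule series_repI[of "\<lambda>n t. h t * c n t" "\<lambda>n. \<kappa> * b n"])
    show "((\<lambda>n. \<kappa> * b n / real n ^ s) has_sum \<kappa> * B) (smooth_numbers P)"
      using has_sum_cmult_right[OF 1(4), of \<kappa>] by simp
    show "norm (h t * c n t) \<le> \<kappa> * b n" if "t \<in> ball 0 5" for n t
      unfolding norm_mult by (intro mult_mono assms 1 that \<kappa>) auto
    show "((\<lambda>n. monomial P \<nu> n * (h t * c n t)) has_sum h t * G \<nu> t) (smooth_numbers P)"
      if "\<nu> \<in> small_params P s" "t \<in> ball 0 5" for \<nu> t
      using has_sum_cmult_right[OF 1(5)[OF that], of "h t"] by (simp add: mult_ac)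
  qed (use 1 assms \<kappa> in \<open>auto intro!: holomorphic_intros\<close>)
qed

lemma multiplier_const: "multiplier P s (norm k) (\<lambda>\<nu> t. k)"
  by (rule multiplier_bounded_holomorphic) auto

lemma multiplier_param:
  assumes P: "\<And>p. p \<in> P \<Longrightarrow> prime p" "finite P" and p: "p \<in> P"
  shows "multiplier P s (1 / real p ^ s) (\<lambda>\<nu> t. \<nu> p)"
  unfolding multiplier_def
proof (intro allI impI)
  fix B G assume "series_rep P s B G"
  then obtain c b where "series_data P s c b B G" unfolding series_rep_def by blast
  note 1 = series_dataD[OF this]
  have p0: "p > 0" using P p prime_gt_0_nat by auto
  have pS: "p \<in> smooth_numbers P" using P p p0 by (auto simp: smooth_numbers_def prime_prime_factors)
  note multiples = has_sum_multiples[OF smooth_numbers_mult_iff pS p0]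
  show "series_rep P s (1 / real p ^ s * B) (\<lambda>\<nu> t. \<nu> p * G \<nu> t)"
  proof (rule series_repI[of "\<lambda>n t. if p dvd n then c (n div p) t else 0" "\<lambda>n. if p dvd n then b (n div p) else 0"])
    show "(\<lambda>t. if p dvd n then c (n div p) t else 0) holomorphic_on ball 0 5" for n
      using 1(1) by (cases "p dvd n") auto
    have "((\<lambda>d. b (p * d div p) / real (p * d) ^ s) has_sum (1 / real p ^ s * B)) (smooth_numbers P)"
      using has_sum_cmult_right[OF 1(4), of "1 / real p ^ s"] p0 by (simp add: power_mult_distrib)
    then have "((\<lambda>n. if p dvd n then b (n div p) / real n ^ s else 0) has_sum (1 / real p ^ s * B)) (smooth_numbers P)"
      by (subst multiples)
    then show "((\<lambda>n. (if p dvd n then b (n div p) else 0) / real n ^ s) has_sum 1 / real p ^ s * B) (smooth_numbers P)"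
      by (rule has_sum_cong[THEN iffD1, rotated]) auto
    fix \<nu> t assume *: "\<nu> \<in> small_params P s" "t \<in> ball (0::complex) 5"
    have "((\<lambda>d. monomial P \<nu> (p * d) * c (p * d div p) t) has_sum \<nu> p * G \<nu> t) (smooth_numbers P)
       \<longleftrightarrow> ((\<lambda>d. \<nu> p * (monomial P \<nu> d * c d t)) has_sum \<nu> p * G \<nu> t) (smooth_numbers P)"
      by (rule has_sum_cong) (use p0 P p in \<open>auto simp: monomial_mult smooth_numbers_pos monomial_prime\<close>)
    then have "((\<lambda>d. monomial P \<nu> (p * d) * c (p * d div p) t) has_sum \<nu> p * G \<nu> t) (smooth_numbers P)"
      using has_sum_cmult_right[OF 1(5)[OF *], of "\<nu> p"] by simp
    then have "((\<lambda>n. if p dvd n then monomial P \<nu> n * c (n div p) t else 0) has_sum \<nu> p * G \<nu> t) (smooth_numbers P)"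
      by (subst multiples)
    then show "((\<lambda>n. monomial P \<nu> n * (if p dvd n then c (n div p) t else 0)) has_sum \<nu> p * G \<nu> t) (smooth_numbers P)"
      by (rule has_sum_cong[THEN iffD1, rotated]) auto
  qed (use 1 in auto)
qed

lemma multiplier_one: "multiplier P s 1 (\<lambda>\<nu> t. 1)"
  using multiplier_const[of P s 1] by simp

lemma multiplier_power: "multiplier P s \<kappa> M \<Longrightarrow> multiplier P s (\<kappa> ^ k) (\<lambda>\<nu> t. M \<nu> t ^ k)"
  by (induction k) (auto intro: multiplier_one multiplier_mult)

lemma multiplier_prod:
  assumes "finite A" "\<And>i. i \<in> A \<Longrightarrow> multiplier P s (\<kappa> i) (M i)"
  shows "multiplier P s (\<Prod>i\<in>A. \<kappa> i) (\<lambda>\<nu> t. \<Prod>i\<in>A. M i \<nu> t)"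
  using assms by (induction rule: finite_induct) (auto intro: multiplier_one multiplier_mult)

lemma series_rep_zero: "series_rep P s 0 (\<lambda>\<nu> t. 0)"
  by (rule series_repI[of "\<lambda>n t. 0" "\<lambda>n. 0"]) auto

lemma series_rep_sum:
  assumes "finite A" "\<And>i. i \<in> A \<Longrightarrow> series_rep P s (B i) (G i)"
  shows "series_rep P s (\<Sum>i\<in>A. B i) (\<lambda>\<nu> t. \<Sum>i\<in>A. G i \<nu> t)"
  using assms by (induction rule: finite_induct) (auto intro: series_rep_zero series_rep_add)

text \<open>Completeness of the majorant norm: summable norms make the double sum over series and
  indices absolutely convergent, so it may be regrouped by index.\<close>

lemma series_rep_infsum:
  assumes P: "\<And>p. p \<in> P \<Longrightarrow> prime p" "finite P"
    and rep: "\<And>i. i \<in> I \<Longrightarrow> series_rep P s (B i) (G i)" and sm: "B summable_on I"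
  shows "series_rep P s (\<Sum>\<^sub>\<infinity>i\<in>I. B i) (\<lambda>\<nu> t. \<Sum>\<^sub>\<infinity>i\<in>I. G i \<nu> t)"
proof -
  let ?S = "smooth_numbers P"
  obtain c b where "\<And>i. i \<in> I \<Longrightarrow> series_data P s (c i) (b i) (B i) (G i)"
    using rep unfolding series_rep_def by metis
  note 1 = series_dataD[OF this]
  have bsm: "(\<lambda>i. b i n) summable_on I" if n: "n \<in> ?S" for n
  proof (rule summable_on_comparison_test)
    show "(\<lambda>i. real n ^ s * B i) summable_on I" by (intro summable_on_cmult_right sm)
    fix i assume i: "i \<in> I"
    have "b i n / real n ^ s \<le> B i"
      using finite_sum_le_has_sum[OF 1(4)[OF i], of "{n}"] n 1(2)[OF i] by auto
    then show "b i n \<le> real n ^ s * B i" using smooth_numbers_pos[OF n] by (simp add: field_simps)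
  qed (use 1 in auto)
  have bB: "(\<lambda>(i, n). b i n / real n ^ s) summable_on (I \<times> ?S)"
    by (rule summable_on_SigmaI[where g = B]) (use 1 sm in auto)
  define c' where "c' n t = (if n \<in> ?S then \<Sum>\<^sub>\<infinity>i\<in>I. c i n t else 0)" for n t
  define b' where "b' n = (if n \<in> ?S then \<Sum>\<^sub>\<infinity>i\<in>I. b i n else 0)" for n
  have csm: "(\<lambda>i. c i n t) summable_on I" if "n \<in> ?S" "t \<in> ball 0 5" for n t
    by (rule abs_summable_summable, rule Infinite_Sum.abs_summable_on_comparison_test'[OF bsm]) (use 1 that in auto)
  show ?thesis
  proof (rule series_repI[of c' b'])
    show "c' n holomorphic_on ball 0 5" for n
    proof (cases "n \<in> ?S")
      case True
      then have "c' n = (\<lambda>t. \<Sum>\<^sub>\<infinity>i\<in>I. c i n t)" by (auto simp: c'_def)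
      moreover have "(\<lambda>t. \<Sum>\<^sub>\<infinity>i\<in>I. c i n t) holomorphic_on ball 0 5"
        by (rule holomorphic_on_infsum[OF _ _ _ bsm[OF True]]) (use 1 in auto)
      ultimately show ?thesis by simp
    qed (simp add: c'_def[abs_def])
    show "b' n \<ge> 0" for n unfolding b'_def using 1(2) by (auto intro: infsum_nonneg)
    show "norm (c' n t) \<le> b' n" if "t \<in> ball 0 5" for n t
      unfolding c'_def b'_def using norm_infsum_le[OF has_sum_infsum[OF csm] has_sum_infsum[OF bsm]] that 1(3) by auto
    show "((\<lambda>n. b' n / real n ^ s) has_sum (\<Sum>\<^sub>\<infinity>i\<in>I. B i)) ?S"
    proof -
      have "((\<lambda>(i, n). b i n / real n ^ s) has_sum (\<Sum>\<^sub>\<infinity>i\<in>I. B i)) (I \<times> ?S)"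
        by (rule has_sum_SigmaI[where g = B]) (use 1 sm bB in auto)
      then have "((\<lambda>(n, i). b i n / real n ^ s) has_sum (\<Sum>\<^sub>\<infinity>i\<in>I. B i)) (?S \<times> I)"
        by (subst has_sum_swap) (simp add: case_prod_unfold)
      then show ?thesis
      proof (rule has_sum_SigmaD)
        fix n assume n: "n \<in> ?S"
        have "((\<lambda>i. b i n * (1 / real n ^ s)) has_sum ((\<Sum>\<^sub>\<infinity>i\<in>I. b i n) * (1 / real n ^ s))) I"
          by (intro has_sum_cmult_left has_sum_infsum bsm n)
        then show "((\<lambda>i. case (n, i) of (n, i) \<Rightarrow> b i n / real n ^ s) has_sum b' n / real n ^ s) I"
          using n by (simp add: b'_def)
      qed
    qed
    fix \<nu> t assume *: "\<nu> \<in> small_params P s" "t \<in> ball (0::complex) 5"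
    note chr = monomial_in_characters[OF P *(1)]
    have "(\<lambda>(i, n). monomial P \<nu> n * c i n t) summable_on (I \<times> ?S)"
    proof (rule summable_on_double_series[OF _ 1(4) sm])
      fix i n assume i: "i \<in> I" "n \<in> ?S"
      have "norm (monomial P \<nu> n * c i n t) \<le> 1 / real n ^ s * b i n"
        unfolding norm_mult using chr i 1(3)[OF i(1) *(2)] by (intro mult_mono) (auto simp: characters_def)
      then show "norm (monomial P \<nu> n * c i n t) \<le> b i n / real n ^ s" by simp
    qed
    moreover have "(\<lambda>i. G i \<nu> t) summable_on I"
      by (rule abs_summable_summable, rule Infinite_Sum.abs_summable_on_comparison_test'[OF sm])
         (use series_rep_norm_le[OF rep P *] in auto)
    ultimately have "((\<lambda>(i, n). monomial P \<nu> n * c i n t) has_sum (\<Sum>\<^sub>\<infinity>i\<in>I. G i \<nu> t)) (I \<times> ?S)"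
      by (intro has_sum_SigmaI[where g = "\<lambda>i. G i \<nu> t"]) (use 1(5) * in auto)
    then have "((\<lambda>(n, i). monomial P \<nu> n * c i n t) has_sum (\<Sum>\<^sub>\<infinity>i\<in>I. G i \<nu> t)) (?S \<times> I)"
      by (subst has_sum_swap) (simp add: case_prod_unfold)
    then show "((\<lambda>n. monomial P \<nu> n * c' n t) has_sum (\<Sum>\<^sub>\<infinity>i\<in>I. G i \<nu> t)) ?S"
    proof (rule has_sum_SigmaD)
      fix n assume n: "n \<in> ?S"
      have "((\<lambda>i. monomial P \<nu> n * c i n t) has_sum (monomial P \<nu> n * (\<Sum>\<^sub>\<infinity>i\<in>I. c i n t))) I"
        by (intro has_sum_cmult_right has_sum_infsum csm n *)
      then show "((\<lambda>i. case (n, i) of (n, i) \<Rightarrow> monomial P \<nu> n * c i n t) has_sum monomial P \<nu> n * c' n t) I"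
        using n by (simp add: c'_def)
    qed
  qed
qed

section \<open>The Bernstein inequality along short segments\<close>

text \<open>It gives every scalar parameter of the local problem a prime of its own.\<close>

lemma ex_inj_primes: "\<exists>pr :: 'v::countable \<Rightarrow> nat. inj pr \<and> (\<forall>v. prime (pr v))"
proof -
  have "inj (\<lambda>v::'v. enumerate {p::nat. prime p} (to_nat v))"
    by (rule injI) (metis from_nat_to_nat primes_infinite strict_mono_enumerate strict_mono_eq)
  moreover have "prime (enumerate {p::nat. prime p} k)" for k
    using enumerate_in_set[OF primes_infinite, of k] by simp
  ultimately show ?thesis by blast
qed

lemma abs_le_distm: "i < m \<Longrightarrow> \<bar>l i - a i\<bar> \<le> distm m a l"
  unfolding distm_def by (rule real_le_rsqrt) (auto intro: member_le_sum[of i "{..<m}" "\<lambda>i. (l i - a i)^2"])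

lemma cvec_add: "cvec (x + y) = cvec x + cvec y"
  and cvec_diff: "cvec (x - y) = cvec x - cvec y"
  and cvec_scaleR: "cvec (r *\<^sub>R x) = of_real r *s cvec x"
  by (auto simp: cvec_def vec_eq_iff)

lemma norm_cvec [simp]: "norm (cvec x) = norm x"
  by (simp add: norm_vec_def cvec_def)

lemma norm_complex_scale: "norm ((t::complex) *s z) = norm t * norm z"
  by (simp add: norm_vec_def norm_mult L2_set_right_distrib)

definition expansion_data ::
    "nat \<Rightarrow> (nat \<Rightarrow> real) set \<Rightarrow> (complex ^ 'n) set \<Rightarrow> (nat \<Rightarrow> real) \<Rightarrow> complex ^ 'n \<Rightarrow>
     ((nat \<Rightarrow> real) \<Rightarrow> complex ^ 'n \<Rightarrow> complex) \<Rightarrow> real \<Rightarrow> real \<Rightarrow> ((nat \<Rightarrow> nat) \<times> ('n \<Rightarrow> nat) \<Rightarrow> complex) \<Rightarrow> bool" where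
  "expansion_data m U D a w F r \<eta> c \<longleftrightarrow> r > 0 \<and> \<eta> > 0 \<and>
    (\<forall>l\<in>U. \<forall>z\<in>D. distm m a l < r \<longrightarrow> dist z w < r \<longrightarrow>
       ((\<lambda>x. c x * (\<Prod>i<m. complex_of_real (l i - a i) ^ fst x i) * (\<Prod>k\<in>UNIV. (z $ k - w $ k) ^ snd x k))
          has_sum F l z) ({\<alpha>. \<forall>i\<ge>m. \<alpha> i = 0} \<times> UNIV)) \<and>
    (\<lambda>x. norm (c x) * (\<Prod>i<m. \<eta> ^ fst x i) * (\<Prod>k\<in>UNIV. \<eta> ^ snd x k)) summable_on ({\<alpha>. \<forall>i\<ge>m. \<alpha> i = 0} \<times> UNIV)"

text \<open>Evaluating the expansion at one point with all increments equal to \<open>\<eta>\<close> gives absolute convergence.\<close>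

lemma analytic_expansion:
  fixes F :: "(nat \<Rightarrow> real) \<Rightarrow> complex ^ 'n \<Rightarrow> complex"
  assumes U: "open_Rm m U" and a: "a \<in> U" and D: "open D" "w \<in> D" and F: "param_analytic m U D F"
  shows "\<exists>r \<eta> c. expansion_data m U D a w F r \<eta> c"
proof -
  obtain r c where r: "r > 0" and exp0: "\<forall>l\<in>U. \<forall>z\<in>D. distm m a l < r \<and> dist z w < r \<longrightarrow>
         ((\<lambda>(\<alpha>, \<beta>). c (\<alpha>, \<beta>) * (\<Prod>i<m. complex_of_real (l i - a i) ^ \<alpha> i)
                        * (\<Prod>k\<in>UNIV. (z $ k - w $ k) ^ \<beta> k))
           has_sum F l z) ({\<alpha>. \<forall>i\<ge>m. \<alpha> i = 0} \<times> UNIV)"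
    using F a D(2) unfolding param_analytic_def by blast
  have expansion: "((\<lambda>x. c x * (\<Prod>i<m. complex_of_real (l i - a i) ^ fst x i) * (\<Prod>k\<in>UNIV. (z $ k - w $ k) ^ snd x k))
          has_sum F l z) ({\<alpha>. \<forall>i\<ge>m. \<alpha> i = 0} \<times> UNIV)"
    if "l \<in> U" "z \<in> D" "distm m a l < r" "dist z w < r" for l z
    using exp0 that by (simp add: case_prod_unfold)
  obtain e where e: "e > 0" "\<And>l. l \<in> Rm m \<Longrightarrow> distm m a l < e \<Longrightarrow> l \<in> U"
    using U a unfolding open_Rm_def by blast
  obtain \<delta> where \<delta>: "\<delta> > 0" "ball w \<delta> \<subseteq> D" using D open_contains_ball by blast
  define \<mu> where "\<mu> = min r (min e \<delta>)"
  have \<mu>: "\<mu> > 0" "\<mu> \<le> r" "\<mu> \<le> e" "\<mu> \<le> \<delta>" using r e \<delta> by (auto simp: \<mu>_def)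
  \<comment> \<open>\<open>M\<close> exceeds both \<open>sqrt m\<close> and \<open>CARD('n)\<close>,
    the factors by which the displacements of \<open>l\<close> and \<open>z\<close> are bounded in
    terms of \<open>\<eta>\<close>; hence both stay below \<open>\<mu>\<close>.\<close>
  define M where "M = 2 + real m + real CARD('n)"
  define \<eta> where "\<eta> = \<mu> / M"
  have M: "M > 0" by (simp add: M_def add_pos_nonneg)
  then have \<eta>: "\<eta> > 0" using \<mu> by (simp add: \<eta>_def)
  have M\<eta>: "M * \<eta> = \<mu>" using M by (simp add: \<eta>_def)
  have small: "x * \<eta> < \<mu>" if "x < M" for x
    using mult_strict_right_mono[OF that \<eta>] M\<eta> by simp
  \<comment> \<open>The value 0 beyond \<open>m\<close> puts \<open>l\<close> into
    \<open>Rm m\<close>, where openness of \<open>U\<close> can be applied.\<close>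
  define l where "l i = (if i < m then a i + \<eta> else 0)" for i
  define z where "z = w + (\<chi> k. complex_of_real \<eta>)"
  have "distm m a l = sqrt (real m) * \<eta>"
    using \<eta> by (simp add: distm_def l_def real_sqrt_mult)
  also have "\<dots> < \<mu>"
  proof (rule small)
    have "real m \<le> (1 + real m)\<^sup>2" by (simp add: power2_eq_square algebra_simps)
    then have "sqrt (real m) \<le> 1 + real m" by (intro real_le_lsqrt) auto
    then show "sqrt (real m) < M" by (simp add: M_def)
  qed
  finally have l: "distm m a l < \<mu>" .
  have "norm (z - w) \<le> (\<Sum>k\<in>UNIV. norm ((z - w) $ k))"
    unfolding norm_vec_def by (rule L2_set_le_sum) auto
  also have "\<dots> = real CARD('n) * \<eta>" using \<eta> by (simp add: z_def)
  also have "\<dots> < \<mu>" by (rule small) (simp add: M_def)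
  finally have z: "dist z w < \<mu>" by (simp add: dist_norm)
  have lU: "l \<in> U" using e l \<mu> by (auto simp: Rm_def l_def)
  have zD: "z \<in> D" using \<delta> z \<mu> by (auto simp: dist_commute)
  have "(\<lambda>x. c x * (\<Prod>i<m. complex_of_real (l i - a i) ^ fst x i) * (\<Prod>k\<in>UNIV. (z $ k - w $ k) ^ snd x k))
      summable_on ({\<alpha>. \<forall>i\<ge>m. \<alpha> i = 0} \<times> UNIV)"
    using expansion[OF lU zD] l z \<mu> has_sum_imp_summable by fastforce
  then have "(\<lambda>x. norm (c x * (\<Prod>i<m. complex_of_real (l i - a i) ^ fst x i) * (\<Prod>k\<in>UNIV. (z $ k - w $ k) ^ snd x k)))
      summable_on ({\<alpha>. \<forall>i\<ge>m. \<alpha> i = 0} \<times> UNIV)"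
    by (rule summable_on_iff_abs_summable_on_complex[THEN iffD1])
  then have "(\<lambda>x. norm (c x) * (\<Prod>i<m. \<eta> ^ fst x i) * (\<Prod>k\<in>UNIV. \<eta> ^ snd x k)) summable_on ({\<alpha>. \<forall>i\<ge>m. \<alpha> i = 0} \<times> UNIV)"
    using \<eta> by (simp add: norm_mult prod_norm[symmetric] norm_power l_def z_def)
  then have "expansion_data m U D a w F r \<eta> c"
    unfolding expansion_data_def using r \<eta> expansion by blast
  then show ?thesis by blast
qed

text \<open>The quantities \<open>l - a\<close>, \<open>y - w\<close>, \<open>v\<close> and a
  rescaled \<open>e\<close> become parameters near zero of a single series, to which
  \<open>finite_determination\<close> applies. At each of its finitely many nodes the value is at
  most \<open>A\<close>, so the sum over nodes costs the factor \<open>card T\<close>.\<close>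

lemma local_bernstein:
  fixes F :: "nat \<Rightarrow> (nat \<Rightarrow> real) \<Rightarrow> complex ^ 'n \<Rightarrow> complex" and w :: "real ^ 'n"
  assumes U: "open_Rm m U" and a: "a \<in> U" and D: "open D" "cvec w \<in> D"
    and F: "\<And>j. j < N \<Longrightarrow> param_analytic m U D (F j)"
  shows "\<exists>\<epsilon>>0. \<exists>C\<ge>0. \<forall>l\<in>U. \<forall>y v. distm m a l < \<epsilon> \<longrightarrow> dist y w < \<epsilon> \<longrightarrow> norm v < \<epsilon> \<longrightarrow>
     (\<forall>e A. (\<forall>\<tau>\<in>{0..1}. norm (\<Sum>j<N. e j * F j l (cvec y + complex_of_real \<tau> *s cvec v)) \<le> A) \<longrightarrow>
        (\<forall>t\<in>ball 0 5. norm (\<Sum>j<N. e j * F j l (cvec y + t *s cvec v)) \<le> C * A))"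
proof -
  let ?I = "{\<alpha>::nat \<Rightarrow> nat. \<forall>i\<ge>m. \<alpha> i = 0} \<times> (UNIV :: ('n \<Rightarrow> nat) set)"
  have "\<exists>r \<eta> c. expansion_data m U D a (cvec w) (F j) r \<eta> c" if "j < N" for j
    by (rule analytic_expansion[OF U a D F[OF that]])
  then obtain r \<eta> c0 where c0: "\<And>j. j < N \<Longrightarrow> expansion_data m U D a (cvec w) (F j) (r j) (\<eta> j) (c0 j)"
    by metis
  have r_pos: "r j > 0" and \<eta>_pos: "\<eta> j > 0"
    and sm: "(\<lambda>x. norm (c0 j x) * (\<Prod>i<m. \<eta> j ^ fst x i) * (\<Prod>k\<in>UNIV. \<eta> j ^ snd x k)) summable_on ?I"
    if "j < N" for j using c0[OF that] unfolding expansion_data_def by blast+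
  have expansion: "((\<lambda>x. c0 j x * (\<Prod>i<m. complex_of_real (l i - a i) ^ fst x i) * (\<Prod>k\<in>UNIV. (z $ k - cvec w $ k) ^ snd x k))
          has_sum F j l z) ?I"
    if "j < N" "l \<in> U" "z \<in> D" "distm m a l < r j" "dist z (cvec w) < r j" for j l z
    using c0[OF that(1)] that(2-) unfolding expansion_data_def by blast
  obtain \<delta> where \<delta>: "\<delta> > 0" "ball (cvec w) \<delta> \<subseteq> D" using D open_contains_ball by blast
  define r0 where "r0 = Min (insert \<delta> (r ` {..<N}))"
  have r0: "r0 > 0" "r0 \<le> \<delta>" "\<And>j. j < N \<Longrightarrow> r0 \<le> r j"
    unfolding r0_def using r_pos \<delta> by (auto simp: Min_gr_iff)
  define \<eta>0 where "\<eta>0 = Min (insert 1 (\<eta> ` {..<N}))"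
  have \<eta>0: "\<eta>0 > 0" "\<And>j. j < N \<Longrightarrow> \<eta>0 \<le> \<eta> j"
    unfolding \<eta>0_def using \<eta>_pos by (auto simp: Min_gr_iff)

  \<comment> \<open>The four summands of the type label \<open>l - a\<close>, the coefficients
    \<open>e\<close>, \<open>y - w\<close> and \<open>v\<close>.\<close>
  obtain pr :: "nat + nat + 'n + 'n \<Rightarrow> nat" where pr: "inj pr" "\<And>v. prime (pr v)"
    using ex_inj_primes by metis
  define pL where "pL i = pr (Inl i)" for i
  define pC where "pC j = pr (Inr (Inl j))" for j
  define pY where "pY k = pr (Inr (Inr (Inl k)))" for k
  define pV where "pV k = pr (Inr (Inr (Inr k)))" for k
  define P where "P = pL ` {..<m} \<union> pC ` {..<N} \<union> range pY \<union> range pV"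
  have finP: "finite P" by (simp add: P_def)
  have primeP: "prime p" if "p \<in> P" for p
    using that pr(2) by (auto simp: P_def pL_def pC_def pY_def pV_def)
  have inP: "i < m \<Longrightarrow> pL i \<in> P" "j < N \<Longrightarrow> pC j \<in> P" "pY k \<in> P" "pV k \<in> P" for i j k
    by (auto simp: P_def)
  \<comment> \<open>For \<open>norm t < 5\<close> the component
    \<open>\<nu> (pY k) + t * \<nu> (pV k)\<close> is bounded by radii with total factor 1 + 5;
    hence the 6, which keeps it within the range of absolute convergence.\<close>
  obtain s where s: "(1/2::real) ^ s < \<eta>0 / 6"
    using real_arch_pow_inv[of "\<eta>0 / 6" "1/2"] \<eta>0 by auto
  have small: "1 / real p ^ s \<le> \<eta>0 / 6" if "p \<in> P" for p
  proof -
    have "2 ^ s \<le> real p ^ s" using prime_ge_2_nat[OF primeP[OF that]] by (intro power_mono) auto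
    then have "1 / real p ^ s \<le> 1 / 2 ^ s" by (intro frac_le) auto
    then show ?thesis using s by (simp add: power_one_over)
  qed
  \<comment> \<open>The expansion of \<open>F j\<close> with arbitrary complex increments; on the
    actual data it returns \<open>F j\<close> along the segment.\<close>
  define G0 where "G0 j \<nu> t = (\<Sum>\<^sub>\<infinity>x\<in>?I. c0 j x * (\<Prod>i<m. \<nu> (pL i) ^ fst x i) *
      (\<Prod>k\<in>UNIV. (\<nu> (pY k) + t * \<nu> (pV k)) ^ snd x k))" for j \<nu> t
  define \<kappa>L where "\<kappa>L i = 1 / real (pL i) ^ s" for i
  define \<kappa>Y where "\<kappa>Y k = 1 / real (pY k) ^ s + 5 * (1 / real (pV k) ^ s)" for k
  have \<kappa>: "\<kappa>L i \<ge> 0" "i < m \<Longrightarrow> \<kappa>L i \<le> \<eta>0" "\<kappa>Y k \<ge> 0" "\<kappa>Y k \<le> \<eta>0" for i k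
    using small[OF inP(1)[of i]] small[OF inP(3)[of k]] small[OF inP(4)[of k]] \<eta>0 unfolding \<kappa>L_def \<kappa>Y_def by auto
  define B0 where "B0 j x = norm (c0 j x) * (\<Prod>i<m. \<kappa>L i ^ fst x i) * (\<Prod>k\<in>UNIV. \<kappa>Y k ^ snd x k)" for j x
  have rep0: "series_rep P s (\<Sum>\<^sub>\<infinity>x\<in>?I. B0 j x) (G0 j)" if j: "j < N" for j
    unfolding G0_def[abs_def]
  proof (rule series_rep_infsum[OF primeP finP])
    have mY: "multiplier P s (\<kappa>Y k) (\<lambda>\<nu> t. \<nu> (pY k) + t * \<nu> (pV k))" for k
      unfolding \<kappa>Y_def
      by (intro multiplier_add multiplier_mult multiplier_param multiplier_bounded_holomorphic)
         (use primeP finP inP in auto)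
    have mL: "multiplier P s (\<kappa>L i) (\<lambda>\<nu> t. \<nu> (pL i))" if "i < m" for i
      unfolding \<kappa>L_def by (rule multiplier_param) (use primeP finP inP that in auto)
    fix x :: "(nat \<Rightarrow> nat) \<times> ('n \<Rightarrow> nat)" assume "x \<in> ?I"
    have "multiplier P s (B0 j x) (\<lambda>\<nu> t. c0 j x * (\<Prod>i<m. \<nu> (pL i) ^ fst x i) *
        (\<Prod>k\<in>UNIV. (\<nu> (pY k) + t * \<nu> (pV k)) ^ snd x k))"
      unfolding B0_def
      by (intro multiplier_mult multiplier_prod multiplier_power multiplier_const mY mL) auto
    then have "series_rep P s (B0 j x * 1) (\<lambda>\<nu> t. c0 j x * (\<Prod>i<m. \<nu> (pL i) ^ fst x i) *
        (\<Prod>k\<in>UNIV. (\<nu> (pY k) + t * \<nu> (pV k)) ^ snd x k) * 1)"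
      unfolding multiplier_def using series_rep_one by blast
    then show "series_rep P s (B0 j x) (\<lambda>\<nu> t. c0 j x * (\<Prod>i<m. \<nu> (pL i) ^ fst x i) *
        (\<Prod>k\<in>UNIV. (\<nu> (pY k) + t * \<nu> (pV k)) ^ snd x k))" by simp
  next
    show "B0 j summable_on ?I"
    proof (rule summable_on_comparison_test[OF sm[OF j]])
      fix x assume "x \<in> ?I"
      have le: "i < m \<Longrightarrow> \<kappa>L i \<le> \<eta> j" "\<kappa>Y k \<le> \<eta> j" for i k
        using \<kappa>(2)[of i] \<kappa>(4)[of k] \<eta>0(2)[OF j] by auto
      have "(\<Prod>i<m. \<kappa>L i ^ fst x i) \<le> (\<Prod>i<m. \<eta> j ^ fst x i)"
        using \<kappa> le by (intro prod_mono) (auto intro!: power_mono)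
      moreover have "(\<Prod>k\<in>UNIV. \<kappa>Y k ^ snd x k) \<le> (\<Prod>k\<in>UNIV. \<eta> j ^ snd x k)"
        using \<kappa> le by (intro prod_mono) (auto intro!: power_mono)
      ultimately show "B0 j x \<le> norm (c0 j x) * (\<Prod>i<m. \<eta> j ^ fst x i) * (\<Prod>k\<in>UNIV. \<eta> j ^ snd x k)"
        unfolding B0_def using \<kappa> \<eta>_pos[OF j] by (intro mult_mono) (auto intro!: prod_nonneg mult_nonneg_nonneg)
    qed (auto simp: B0_def \<kappa> intro!: prod_nonneg mult_nonneg_nonneg)
  qed
  define G where "G \<nu> t = (\<Sum>j<N. \<nu> (pC j) * G0 j \<nu> t)" for \<nu> t
  have "\<exists>B. series_rep P s B G"
    unfolding G_def[abs_def]
  proof (rule exI, rule series_rep_sum)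
    fix j assume "j \<in> {..<N}"
    then show "series_rep P s (1 / real (pC j) ^ s * (\<Sum>\<^sub>\<infinity>x\<in>?I. B0 j x)) (\<lambda>\<nu> t. \<nu> (pC j) * G0 j \<nu> t)"
      using multiplier_param[OF primeP finP inP(2)[of j], of s] rep0[of j] unfolding multiplier_def by blast
  qed simp
  then obtain B c b where "series_data P s c b B G" unfolding series_rep_def by blast
  note data = series_dataD[OF this]
  interpret cs: controlled_series "smooth_numbers P" "{f. f holomorphic_on ball 0 5}" "ball 0 5"
      "complex_of_real ` {0..1}" c b s
  proof
    fix f and x :: complex
    assume f: "f \<in> {f. f holomorphic_on ball 0 5}" and 0: "\<And>t. t \<in> complex_of_real ` {0..1} \<Longrightarrow> f t = 0"
      and x: "x \<in> ball 0 5"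
    \<comment> \<open>A limit point of the segment inside the disc is what the identity theorem asks
      for.\<close>
    have "(0::complex) islimpt complex_of_real ` {0..1}"
    proof (rule islimptI)
      fix T assume "(0::complex) \<in> T" "open T"
      then obtain e where e: "e > 0" "ball 0 e \<subseteq> T" using open_contains_ball by blast
      show "\<exists>y\<in>complex_of_real ` {0..1}. y \<in> T \<and> y \<noteq> 0"
        by (rule bexI[of _ "complex_of_real (min 1 (e/2))"]) (use e in auto)
    qed
    then show "f x = 0"
      by (rule analytic_continuation[of f "ball 0 5" "complex_of_real ` {0..1}" 0 x, rotated 5])
         (use f 0 x in auto)
  next
    show "(\<lambda>x. f x - k * g x) \<in> {f. f holomorphic_on ball 0 5}"
      if "f \<in> {f. f holomorphic_on ball 0 5}" "g \<in> {f. f holomorphic_on ball 0 5}" for f g k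
      using that by (auto intro!: holomorphic_intros)
    show "\<exists>B. finite B \<and> B \<subseteq> A \<and> (\<forall>a\<in>A. \<exists>b\<in>B. b dvd a)" if "A \<subseteq> smooth_numbers P" for A
      by (rule dickson_smooth_numbers[OF finP primeP that])
    show "(\<lambda>n. b n / real n ^ s) summable_on smooth_numbers P"
      using data(4) by (rule has_sum_imp_summable)
  qed (use data smooth_numbers_pos smooth_numbers_mult_iff in auto)
  obtain s' T C where s': "s' \<ge> s" and T: "finite T" "T \<subseteq> complex_of_real ` {0..1}" and C: "C \<ge> 0"
    and det: "\<And>\<psi> t. \<psi> \<in> characters (smooth_numbers P) s' \<Longrightarrow> t \<in> ball 0 5 \<Longrightarrow>
        norm (cs.G \<psi> t) \<le> C * (\<Sum>\<tau>\<in>T. norm (cs.G \<psi> \<tau>))"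
    using cs.finite_determination by blast
  define \<theta> where "\<theta> = Min (insert 1 ((\<lambda>p. 1 / real p ^ s') ` P))"
  have \<theta>: "\<theta> > 0" "\<And>p. p \<in> P \<Longrightarrow> \<theta> \<le> 1 / real p ^ s'"
    unfolding \<theta>_def using finP primeP prime_gt_0_nat by (auto simp: Min_gr_iff)
  \<comment> \<open>The divisor 6 is again 1 + 5: the point \<open>y - w + t v\<close> has norm
    below \<open>\<epsilon> + 5 * \<epsilon>\<close>, which must not leave the domain of the
    expansions.\<close>
  define \<epsilon> where "\<epsilon> = min \<theta> (r0 / 6)"
  have \<epsilon>: "\<epsilon> > 0" "\<epsilon> \<le> \<theta>" "6 * \<epsilon> \<le> r0" using \<theta> r0 by (auto simp: \<epsilon>_def)
  show ?thesis
  proof (rule exI[of _ \<epsilon>], rule conjI[OF \<epsilon>(1)], rule exI[of _ "C * real (card T)"],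
      intro conjI ballI allI impI)
    fix l y v e A and t :: complex
    assume l: "l \<in> U" "distm m a l < \<epsilon>" and y: "dist y w < \<epsilon>" and v: "norm v < \<epsilon>"
      and A: "\<forall>\<tau>\<in>{0..1}. norm (\<Sum>j<N. e j * F j l (cvec y + complex_of_real \<tau> *s cvec v)) \<le> A"
      and t: "t \<in> ball 0 5"
    define f where "f t = (\<Sum>j<N. e j * F j l (cvec y + t *s cvec v))" for t
    \<comment> \<open>The inequality is homogeneous in \<open>e\<close>, so \<open>e\<close> can be scaled into the polydisc.\<close>
    define q where "q = \<theta> / (1 + (\<Sum>j<N. norm (e j)))"
    have pos: "1 + (\<Sum>j<N. norm (e j)) > 0" by (intro add_pos_nonneg sum_nonneg) auto
    then have q: "q > 0" using \<theta> by (simp add: q_def)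
    have qe: "norm (of_real q * e j) \<le> \<theta>" if "j < N" for j
    proof -
      have "norm (e j) \<le> 1 + (\<Sum>j<N. norm (e j))"
        using member_le_sum[of j "{..<N}" "\<lambda>j. norm (e j)"] that by simp
      then have "\<theta> * norm (e j) \<le> \<theta> * (1 + (\<Sum>j<N. norm (e j)))" using \<theta> by (intro mult_left_mono) auto
      then have "q * norm (e j) \<le> \<theta>" using pos by (simp add: q_def divide_le_eq)
      then show ?thesis using q by (simp add: norm_mult)
    qed
    define val where "val = case_sum (\<lambda>i. complex_of_real (l i - a i)) (case_sum (\<lambda>j. of_real q * e j)
       (case_sum (\<lambda>k. complex_of_real (y $ k - w $ k)) (\<lambda>k. complex_of_real (v $ k))))"
    define \<nu> where "\<nu> p = val (inv pr p)" for p
    have \<nu>: "\<nu> (pL i) = complex_of_real (l i - a i)" "\<nu> (pC j) = of_real q * e j"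
        "\<nu> (pY k) = complex_of_real (y $ k - w $ k)" "\<nu> (pV k) = complex_of_real (v $ k)" for i j k
      by (simp_all add: \<nu>_def val_def pL_def pC_def pY_def pV_def inv_f_f[OF pr(1)])
    have "norm (\<nu> p) \<le> \<theta>" if "p \<in> P" for p
    proof -
      have "\<bar>l i - a i\<bar> \<le> \<theta>" if "i < m" for i using abs_le_distm[OF that, of l a] l \<epsilon> by simp
      moreover have "\<bar>y $ k - w $ k\<bar> \<le> \<theta>" for k
        using component_le_norm_cart[of "y - w" k] y \<epsilon> by (simp add: dist_norm)
      moreover have "\<bar>v $ k\<bar> \<le> \<theta>" for k using component_le_norm_cart[of v k] v \<epsilon> by simp
      ultimately show ?thesis
        using that qe by (auto simp: P_def \<nu> simp flip: of_real_diff)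
    qed
    then have \<nu>s': "\<nu> \<in> small_params P s'" using \<theta>(2) by (force simp: small_params_def)
    have \<nu>s: "\<nu> \<in> small_params P s"
    proof -
      have "1 / real p ^ s' \<le> 1 / real p ^ s" if "p \<in> P" for p
        using prime_gt_0_nat[OF primeP[OF that]] s' by (intro divide_left_mono power_increasing) auto
      then show ?thesis using \<nu>s' by (force simp: small_params_def)
    qed
    have eval: "cs.G (monomial P \<nu>) u = of_real q * f u" if u: "u \<in> ball 0 5" for u
    proof -
      have "cs.G (monomial P \<nu>) u = G \<nu> u"
        unfolding cs.G_def by (rule infsumI) (rule data(5)[OF \<nu>s u])
      also have "\<dots> = (\<Sum>j<N. of_real q * e j * F j l (cvec y + u *s cvec v))"
        unfolding G_def
      proof (rule sum.cong)
        fix j assume "j \<in> {..<N}"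
        then have j: "j < N" by simp
        let ?z = "cvec y + u *s cvec v"
        have "norm (?z - cvec w) = norm (cvec (y - w) + u *s cvec v)" by (simp add: cvec_diff algebra_simps)
        also have "\<dots> \<le> norm (y - w) + norm u * norm v"
          using norm_triangle_ineq[of "cvec (y - w)" "u *s cvec v"] by (simp add: norm_complex_scale)
        also have "norm u * norm v \<le> 5 * \<epsilon>" using u v by (intro mult_mono) auto
        finally have z: "dist ?z (cvec w) < r0" using y \<epsilon> by (simp add: dist_norm)
        have zD: "?z \<in> D" using z \<delta> r0 by (auto simp: dist_commute)
        have "F j l ?z = G0 j \<nu> u"
          unfolding G0_def
          by (rule infsumI[symmetric], rule has_sum_cong[THEN iffD1, OF _ expansion[OF j l(1) zD]])
             (use z l \<epsilon> r0(3)[OF j] in \<open>auto simp: \<nu> cvec_def algebra_simps\<close>)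
        then show "\<nu> (pC j) * G0 j \<nu> u = of_real q * e j * F j l ?z" by (simp add: \<nu>)
      qed simp
      also have "\<dots> = of_real q * f u" by (simp add: f_def sum_distrib_left mult_ac)
      finally show ?thesis .
    qed
    have "norm (of_real q * f t) \<le> C * (\<Sum>\<tau>\<in>T. norm (of_real q * f \<tau>))"
    proof -
      have "(\<Sum>\<tau>\<in>T. norm (cs.G (monomial P \<nu>) \<tau>)) = (\<Sum>\<tau>\<in>T. norm (of_real q * f \<tau>))"
        by (rule sum.cong) (use T(2) in \<open>auto intro!: arg_cong[where f = norm] eval\<close>)
      then show ?thesis
        using det[OF monomial_in_characters[OF primeP finP \<nu>s'] t] eval[OF t] by simp
    qed
    also have "\<dots> \<le> C * (\<Sum>\<tau>\<in>T. q * A)"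
    proof (intro mult_left_mono sum_mono C)
      fix \<tau> assume "\<tau> \<in> T"
      then have "norm (f \<tau>) \<le> A" using T(2) A by (auto simp: f_def)
      then show "norm (of_real q * f \<tau>) \<le> q * A" using q by (simp add: norm_mult)
    qed
    finally have "q * norm (f t) \<le> q * (C * real (card T) * A)" using q by (simp add: norm_mult mult_ac)
    then show "norm (\<Sum>j<N. e j * F j l (cvec y + t *s cvec v)) \<le> C * real (card T) * A"
      using q by (simp add: f_def)
  qed (use \<epsilon> C in auto)
qed

section \<open>Remez inequalities\<close>

lemma holomorphic_factor_zeros:
  assumes "finite T" "open S" "T \<subseteq> S" "f holomorphic_on S" "\<And>t. t \<in> T \<Longrightarrow> f t = 0"
  shows "\<exists>h. h holomorphic_on S \<and> (\<forall>z. f z = h z * (\<Prod>t\<in>T. z - t))"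
  using assms
proof (induction T arbitrary: f rule: finite_induct)
  case empty then show ?case by (intro exI[of _ f]) auto
next
  case (insert a T)
  define g where "g z = (if z = a then deriv f a else (f z - f a) / (z - a))" for z
  have g: "g holomorphic_on S" unfolding g_def[abs_def]
    by (rule pole_lemma_open) (use insert in auto)
  have fg: "f z = (z - a) * g z" for z using insert.prems(4)[of a] by (auto simp: g_def)
  have "g t = 0" if "t \<in> T" for t
    using fg[of t] insert.prems(4)[of t] insert.hyps that by auto
  then obtain h where "h holomorphic_on S" "\<forall>z. g z = h z * (\<Prod>t\<in>T. z - t)"
    using insert.IH[of g] g insert.prems by auto
  then show ?case using fg insert.hyps by (intro exI[of _ h]) (auto simp: mult_ac)
qed

text \<open>Divide out the zeros and apply the maximum principle on the disc of radius 4: on its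
  boundary each factor \<open>z - t\<close> has norm at least 3, while between points of [0, 1] it
  has norm at most 1.\<close>

lemma schwarz_many_zeros:
  fixes f :: "complex \<Rightarrow> complex"
  assumes hol: "f holomorphic_on ball 0 5" and T: "finite T" "T \<subseteq> of_real ` {0..1}"
    and zero: "\<And>t. t \<in> T \<Longrightarrow> f t = 0" and le: "\<And>z. norm z = 4 \<Longrightarrow> norm (f z) \<le> B"
    and \<tau>: "\<tau> \<in> of_real ` {0..1}"
  shows "norm (f \<tau>) \<le> B / 3 ^ card T"
proof -
  have "T \<subseteq> ball 0 5" using T(2) by auto
  then obtain h where h: "h holomorphic_on ball 0 5" "\<And>z. f z = h z * (\<Prod>t\<in>T. z - t)"
    using holomorphic_factor_zeros[OF T(1) open_ball _ hol zero] by blast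
  have "norm (h \<tau>) \<le> B / 3 ^ card T"
  proof (rule maximum_modulus_frontier[of h "ball 0 4"])
    show "h holomorphic_on interior (ball 0 4)" using h(1) by (rule holomorphic_on_subset) auto
    show "continuous_on (closure (ball 0 4)) h"
      by (rule continuous_on_subset[OF holomorphic_on_imp_continuous_on[OF h(1)]]) auto
    show "\<tau> \<in> ball 0 4" using \<tau> by auto
    fix z :: complex assume "z \<in> frontier (ball 0 4)"
    then have z: "norm z = 4" by simp
    have "(3::real) ^ card T = (\<Prod>t\<in>T. 3)" by simp
    also have "\<dots> \<le> (\<Prod>t\<in>T. norm (z - t))"
    proof (rule prod_mono)
      fix t assume "t \<in> T"
      then have "norm t \<le> 1" using T(2) by auto
      then show "0 \<le> (3::real) \<and> 3 \<le> norm (z - t)" using norm_triangle_ineq2[of z t] z by auto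
    qed
    also have "\<dots> = norm (\<Prod>t\<in>T. z - t)" by (rule prod_norm)
    finally have "norm (h z) * 3 ^ card T \<le> norm (h z) * norm (\<Prod>t\<in>T. z - t)"
      by (intro mult_left_mono) auto
    also have "\<dots> = norm (f z)" by (simp add: h(2) norm_mult)
    also have "\<dots> \<le> B" by (rule le[OF z])
    finally show "norm (h z) \<le> B / 3 ^ card T" by (simp add: field_simps)
  qed auto
  moreover have "norm (\<Prod>t\<in>T. \<tau> - t) \<le> 1"
  proof -
    have "norm (\<tau> - t) \<le> 1" if "t \<in> T" for t
    proof -
      have "t \<in> of_real ` {0..1}" using that T(2) by auto
      then show ?thesis using \<tau> by (auto simp: simp flip: of_real_diff)
    qed
    then show ?thesis unfolding prod_norm[symmetric] by (intro prod_le_1) auto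
  qed
  ultimately show ?thesis unfolding h(2) norm_mult
    using mult_mono[of "norm (h \<tau>)" "B / 3 ^ card T" "norm (\<Prod>t\<in>T. \<tau> - t)" 1]
    by (smt (verit) norm_ge_zero mult.right_neutral)
qed

text \<open>Greedy choice: the intervals of radius \<open>h\<close> around the points found so far
  have total length less than that of \<open>E\<close>, so a further point of \<open>E\<close> lies
  outside all of them.\<close>

lemma separated_points:
  fixes E :: "real set"
  assumes E: "E \<in> lmeasurable" and h: "h > 0" "2 * h * real k < measure lebesgue E"
  shows "\<exists>T. finite T \<and> card T = Suc k \<and> T \<subseteq> E \<and> (\<forall>t\<in>T. \<forall>u\<in>T. t \<noteq> u \<longrightarrow> \<bar>t - u\<bar> \<ge> h)"
  using h(2)
proof (induction k)
  case 0
  then have "E \<noteq> {}" by auto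
  then obtain t where "t \<in> E" by auto
  then show ?case by (intro exI[of _ "{t}"]) auto
next
  case (Suc k)
  have "2 * h * real k \<le> 2 * h * real (Suc k)" using h by (intro mult_left_mono) auto
  then obtain T where T: "finite T" "card T = Suc k" "T \<subseteq> E" "\<forall>t\<in>T. \<forall>u\<in>T. t \<noteq> u \<longrightarrow> \<bar>t - u\<bar> \<ge> h"
    using Suc by force
  have "\<not> E \<subseteq> (\<Union>t\<in>T. ball t h)"
  proof
    assume "E \<subseteq> (\<Union>t\<in>T. ball t h)"
    then have "measure lebesgue E \<le> measure lebesgue (\<Union>t\<in>T. ball t h)"
      using T(1) E by (intro measure_mono_fmeasurable) (auto intro!: fmeasurable.finite_UN fmeasurableD)
    also have "\<dots> \<le> (\<Sum>t\<in>T. measure lebesgue (ball t h))"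
      using T(1) by (intro measure_UNION_le) auto
    also have "\<dots> = 2 * h * real (Suc k)"
      using h T(2) by (simp add: ball_eq_greaterThanLessThan)
    finally show False using Suc.prems by simp
  qed
  then obtain u where u: "u \<in> E" "\<And>t. t \<in> T \<Longrightarrow> \<bar>t - u\<bar> \<ge> h" by (force simp: dist_real_def)
  have "u \<notin> T" using u(2)[of u] h by auto
  then show ?case using T u by (intro exI[of _ "insert u T"]) (auto simp: abs_minus_commute)
qed

text \<open>Each Lagrange factor is at most \<open>5 / h\<close>: the numerator by 4 + 1, the
  denominator by separation.\<close>

lemma lagrange_polynomial_le:
  fixes f :: "complex \<Rightarrow> complex"
  assumes T: "finite T" "card T = Suc k" "T \<subseteq> cball 0 1" and h: "0 < h"
    and sep: "\<And>t u. t \<in> T \<Longrightarrow> u \<in> T \<Longrightarrow> t \<noteq> u \<Longrightarrow> norm (t - u) \<ge> h"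
    and f: "\<And>t. t \<in> T \<Longrightarrow> norm (f t) \<le> \<epsilon>" and z: "norm z \<le> 4"
  shows "norm (\<Sum>t\<in>T. f t * (\<Prod>u\<in>T - {t}. (z - u) / (t - u))) \<le> real (Suc k) * \<epsilon> * (5 / h) ^ k"
proof -
  have "norm (f t * (\<Prod>u\<in>T - {t}. (z - u) / (t - u))) \<le> \<epsilon> * (5 / h) ^ k" if t: "t \<in> T" for t
  proof -
    have "(\<Prod>u\<in>T - {t}. norm ((z - u) / (t - u))) \<le> (\<Prod>u\<in>T - {t}. 5 / h)"
    proof (rule prod_mono)
      fix u assume u: "u \<in> T - {t}"
      then have "norm (z - u) \<le> 5" using norm_triangle_ineq4[of z u] z T(3) by (auto simp: subset_iff)
      then show "0 \<le> norm ((z - u) / (t - u)) \<and> norm ((z - u) / (t - u)) \<le> 5 / h"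
        using sep[OF t, of u] u h by (auto simp: norm_divide intro!: frac_le)
    qed
    also have "\<dots> = (5 / h) ^ k" using T t by simp
    finally show ?thesis unfolding norm_mult prod_norm[symmetric]
      using f[OF t] order_trans[OF norm_ge_zero f[OF t]] by (intro mult_mono) (auto intro: prod_nonneg)
  qed
  then have "norm (\<Sum>t\<in>T. f t * (\<Prod>u\<in>T - {t}. (z - u) / (t - u))) \<le> (\<Sum>t\<in>T. \<epsilon> * (5 / h) ^ k)"
    by (rule sum_norm_le)
  then show ?thesis using T by simp
qed

text \<open>Interpolate \<open>f\<close> at \<open>k + 1\<close> separated points of
  \<open>E\<close>. The interpolant is bounded by a multiple \<open>Q\<close> of
  \<open>\<epsilon>\<close>, and the error has \<open>k + 1\<close> zeros, so on [0, 1] it is at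
  most \<open>(C * A + Q) / 3 ^ (k + 1) \<le> A / 3 + Q\<close>. At a point where the maximum
  \<open>A\<close> is attained, the term \<open>A / 3\<close> can be absorbed.\<close>

lemma remez_holomorphic:
  fixes f :: "complex \<Rightarrow> complex"
  assumes hol: "f holomorphic_on ball 0 5" and C: "C \<le> 3 ^ k"
    and bern: "\<And>t. t \<in> ball 0 5 \<Longrightarrow> norm (f t) \<le> C * A"
    and A: "\<And>t. t \<in> {0..1} \<Longrightarrow> norm (f (of_real t)) \<le> A" "\<exists>t\<in>{0..1}. norm (f (of_real t)) = A"
    and E: "E \<in> sets lebesgue" "E \<subseteq> {0..1}" "measure lebesgue E \<ge> \<delta>" "\<delta> > 0"
    and \<epsilon>: "\<And>t. t \<in> E \<Longrightarrow> norm (f (of_real t)) \<le> \<epsilon>"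
  shows "A \<le> 4 * real (Suc k) * \<epsilon> * (10 * real (Suc k) / \<delta>) ^ k"
proof -
  \<comment> \<open>With \<open>k + 1\<close> in the denominator, \<open>k\<close> intervals of
    length \<open>2 * h\<close> do not exhaust \<open>E\<close>, which leaves room for the last
    node.\<close>
  define h where "h = \<delta> / (2 * real (Suc k))"
  have h: "h > 0" using E(4) by (simp add: h_def)
  have "2 * h * real k < \<delta>" using E(4) by (simp add: h_def field_simps)
  moreover have lm: "E \<in> lmeasurable"
    by (rule bounded_set_imp_lmeasurable) (use E bounded_subset[of "{0..1::real}"] in auto)
  ultimately obtain R where R: "finite R" "card R = Suc k" "R \<subseteq> E" "\<forall>t\<in>R. \<forall>u\<in>R. t \<noteq> u \<longrightarrow> \<bar>t - u\<bar> \<ge> h"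
    using separated_points[OF lm h, of k] E(3) by auto
  define T where "T = complex_of_real ` R"
  have T: "finite T" "card T = Suc k" "T \<subseteq> of_real ` {0..1}" "T \<subseteq> cball 0 1"
    using R E(2) by (auto simp: T_def card_image inj_on_def)
  have sep: "norm (t - u) \<ge> h" if "t \<in> T" "u \<in> T" "t \<noteq> u" for t u
    using that R(4) by (auto simp: T_def simp flip: of_real_diff)
  define p where "p z = (\<Sum>t\<in>T. f t * (\<Prod>u\<in>T - {t}. (z - u) / (t - u)))" for z
  define Q where "Q = real (Suc k) * \<epsilon> * (5 / h) ^ k"
  have p_le: "norm (p z) \<le> Q" if "norm z \<le> 4" for z
    unfolding p_def Q_def by (rule lagrange_polynomial_le[OF T(1,2,4) h sep _ that]) (use \<epsilon> R(3) in \<open>auto simp: T_def\<close>)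
  obtain \<tau> where \<tau>: "\<tau> \<in> {0..1}" "norm (f (of_real \<tau>)) = A" using A(2) by blast
  have A0: "A \<ge> 0" using norm_ge_zero[of "f (of_real \<tau>)"] \<tau>(2) by simp
  have Q0: "Q \<ge> 0" using order_trans[OF norm_ge_zero p_le[of 0]] by simp
  have "norm (f (of_real \<tau>) - p (of_real \<tau>)) \<le> (C * A + Q) / 3 ^ card T"
  proof (rule schwarz_many_zeros[of "\<lambda>z. f z - p z", OF _ T(1,3)])
    show "(\<lambda>z. f z - p z) holomorphic_on ball 0 5"
      unfolding p_def divide_inverse by (intro holomorphic_intros hol)
    fix t assume t: "t \<in> T"
    have "p t = (\<Sum>s\<in>T. if s = t then f t else 0)"
      unfolding p_def
    proof (rule sum.cong)
      fix s assume "s \<in> T"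
      show "f s * (\<Prod>u\<in>T - {s}. (t - u) / (s - u)) = (if s = t then f t else 0)"
      proof (cases "s = t")
        case False
        then have "(\<Prod>u\<in>T - {s}. (t - u) / (s - u)) = 0" using t T(1) by (subst prod_zero_iff) auto
        then show ?thesis using False by simp
      qed (auto intro!: prod.neutral split: if_splits)
    qed simp
    then show "f t - p t = 0" using t T(1) by simp
  next
    fix z :: complex assume "norm z = 4"
    then show "norm (f z - p z) \<le> C * A + Q"
      using norm_triangle_ineq4[of "f z" "p z"] bern[of z] p_le[of z] by simp
  qed (use \<tau> in auto)
  also have "\<dots> \<le> A / 3 + Q"
  proof -
    have "C * A \<le> 3 ^ k * A" by (intro mult_right_mono C A0)
    moreover have "Q \<le> Q * 3 ^ Suc k" using Q0 one_le_power[of "3::real" "Suc k"] mult_left_mono[of 1 "3 ^ Suc k" Q] by simp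
    ultimately have "C * A + Q \<le> (A / 3 + Q) * 3 ^ Suc k" by (simp add: algebra_simps)
    then show ?thesis unfolding T(2) by (simp add: divide_le_eq del: power_Suc)
  qed
  finally have "norm (f (of_real \<tau>) - p (of_real \<tau>)) \<le> A / 3 + Q" .
  moreover have "norm (p (of_real \<tau>)) \<le> Q" using \<tau> by (intro p_le) auto
  ultimately have "A \<le> A / 3 + 2 * Q"
    using norm_triangle_sub[of "f (of_real \<tau>)" "p (of_real \<tau>)"] \<tau>(2) by simp
  then have "A \<le> 4 * Q" using Q0 by simp
  also have "5 / h = 10 * real (Suc k) / \<delta>" using E(4) by (simp add: h_def)
  then have "4 * Q = 4 * real (Suc k) * \<epsilon> * (10 * real (Suc k) / \<delta>) ^ k" by (simp add: Q_def)
  finally show ?thesis .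
qed

section \<open>Uniformity in the parameter and the base point by compactness\<close>

lemma uniform_bernstein:
  fixes F :: "nat \<Rightarrow> (nat \<Rightarrow> real) \<Rightarrow> complex ^ 'n \<Rightarrow> complex"
  assumes U: "open_Rm m U" and K: "compact K" "K \<subseteq> U" and D: "open D" "\<And>w::real^'n. norm w \<le> 1 \<Longrightarrow> cvec w \<in> D"
    and F: "\<And>j. j < N \<Longrightarrow> param_analytic m U D (F j)"
  obtains \<epsilon> C where "\<epsilon> > 0" "C \<ge> 1"
    "\<And>l y v e A t. l \<in> K \<Longrightarrow> norm y \<le> 1 \<Longrightarrow> norm v < \<epsilon> \<Longrightarrow>
       (\<And>\<tau>. \<tau> \<in> {0..1} \<Longrightarrow> norm (\<Sum>j<N. e j * F j l (cvec y + complex_of_real \<tau> *s cvec v)) \<le> A) \<Longrightarrow>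
       t \<in> ball 0 5 \<Longrightarrow> norm (\<Sum>j<N. e j * F j l (cvec y + t *s cvec v)) \<le> C * A"
proof -
  define Q where "Q a w \<epsilon> C \<longleftrightarrow> (\<forall>l\<in>U. \<forall>y v. distm m a l < \<epsilon> \<longrightarrow> dist y w < \<epsilon> \<longrightarrow> norm v < \<epsilon> \<longrightarrow>
     (\<forall>e A. (\<forall>\<tau>\<in>{0..1}. norm (\<Sum>j<N. e j * F j l (cvec y + complex_of_real \<tau> *s cvec v)) \<le> A) \<longrightarrow>
        (\<forall>t\<in>ball 0 5. norm (\<Sum>j<N. e j * F j l (cvec y + t *s cvec v)) \<le> C * A)))" for a w \<epsilon> C
  have "\<exists>\<epsilon>>0. \<exists>C\<ge>0. Q a w \<epsilon> C" if "a \<in> K" "norm w \<le> 1" for a w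
    unfolding Q_def by (rule local_bernstein[OF U _ D(1) D(2) F]) (use that K in auto)
  then have "\<forall>p\<in>K \<times> cball 0 1. \<exists>\<epsilon> C. \<epsilon> > 0 \<and> C \<ge> 0 \<and> Q (fst p) (snd p) \<epsilon> C" by fastforce
  then obtain \<epsilon> C where Q: "\<And>p. p \<in> K \<times> cball 0 1 \<Longrightarrow> \<epsilon> p > 0 \<and> C p \<ge> 0 \<and> Q (fst p) (snd p) (\<epsilon> p) (C p)" by metis
  define O' where "O' p = {x. distm m (fst p) (fst x) < \<epsilon> p \<and> dist (snd x) (snd p) < \<epsilon> p}" for p :: "(nat \<Rightarrow> real) \<times> (real ^ 'n)"
  \<comment> \<open>Compactness of \<open>K\<close> refers to the product topology on sequences. As
    \<open>distm\<close> involves only the first \<open>m\<close> coordinates, it is continuous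
    there and its balls form an open cover.\<close>
  have cont: "continuous_on UNIV (\<lambda>x::(nat \<Rightarrow> real) \<times> (real ^ 'n). distm m a (fst x))" for a
  proof -
    have "continuous_on UNIV (\<lambda>x::(nat \<Rightarrow> real) \<times> (real ^ 'n). fst x i)" for i
      by (rule continuous_on_product_then_coordinatewise) (intro continuous_intros)
    then show ?thesis unfolding distm_def by (intro continuous_intros)
  qed
  have openO: "open (O' p)" for p
    unfolding O'_def by (intro open_Collect_conj open_Collect_less continuous_intros cont)
  have comp: "compact (K \<times> cball (0::real^'n) 1)" using K by (intro compact_Times) auto
  have cover: "K \<times> cball 0 1 \<subseteq> (\<Union>p\<in>K \<times> cball 0 1. O' p)"
    using Q by (force simp: O'_def distm_def)
  from compactE_image[OF comp openO cover] obtain J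
    where J: "J \<subseteq> K \<times> cball 0 1" "finite J" "K \<times> cball 0 1 \<subseteq> (\<Union>p\<in>J. O' p)" by metis
  have QJ: "\<epsilon> p > 0" "C p \<ge> 0" "Q (fst p) (snd p) (\<epsilon> p) (C p)" if "p \<in> J" for p using Q J that by auto
  define \<epsilon>0 where "\<epsilon>0 = Min (insert 1 (\<epsilon> ` J))"
  have \<epsilon>0: "\<epsilon>0 > 0" "\<And>p. p \<in> J \<Longrightarrow> \<epsilon>0 \<le> \<epsilon> p"
    unfolding \<epsilon>0_def using J QJ by (auto simp: Min_gr_iff)
  have C0: "(\<Sum>p\<in>J. C p) \<ge> 0" using QJ by (intro sum_nonneg) auto
  show thesis
  \<comment> \<open>The sum over the finite subcover dominates every local constant; the added 1
    makes the result at least 1, so its powers can be compared later.\<close>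
  proof (rule that[OF \<epsilon>0(1), of "1 + (\<Sum>p\<in>J. C p)"])
    show "1 \<le> 1 + (\<Sum>p\<in>J. C p)" using C0 by simp
    fix l y v e A and t :: complex
    assume l: "l \<in> K" and y: "norm y \<le> 1" and v: "norm v < \<epsilon>0" and t: "t \<in> ball 0 5"
      and A: "\<And>\<tau>. \<tau> \<in> {0..1} \<Longrightarrow> norm (\<Sum>j<N. e j * F j l (cvec y + complex_of_real \<tau> *s cvec v)) \<le> A"
    have "(l, y) \<in> K \<times> cball 0 1" using l y by simp
    then obtain p where p: "p \<in> J" "(l, y) \<in> O' p" using J(3) by blast
    then have "norm v < \<epsilon> p" "distm m (fst p) l < \<epsilon> p" "dist y (snd p) < \<epsilon> p"
      using v \<epsilon>0(2)[OF p(1)] by (auto simp: O'_def)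
    then have "norm (\<Sum>j<N. e j * F j l (cvec y + t *s cvec v)) \<le> C p * A"
      using QJ(3)[OF p(1)] l K(2) A t unfolding Q_def by blast
    also have "\<dots> \<le> (1 + (\<Sum>p\<in>J. C p)) * A"
    proof (rule mult_right_mono)
      have "C p \<le> (\<Sum>p\<in>J. C p)" using p J QJ by (intro member_le_sum) auto
      then show "C p \<le> 1 + (\<Sum>p\<in>J. C p)" by simp
      show "A \<ge> 0" using order_trans[OF norm_ge_zero A[of 0]] by simp
    qed
    finally show "norm (\<Sum>j<N. e j * F j l (cvec y + t *s cvec v)) \<le> (1 + (\<Sum>p\<in>J. C p)) * A" .
  qed
qed

lemma holo_n_along_line:
  fixes f :: "complex ^ 'n \<Rightarrow> complex"
  assumes "holo_n S f" "open A" "\<And>t. t \<in> A \<Longrightarrow> z + t *s v \<in> S"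
  shows "(\<lambda>t. f (z + t *s v)) holomorphic_on A"
proof -
  have "(\<lambda>t. f (z + t *s v)) field_differentiable at t" if t: "t \<in> A" for t
  proof -
    obtain D where D: "(f has_derivative D) (at (z + t *s v))" "\<And>c v. D (c *s v) = c * D v"
      using assms t unfolding holo_n_def by blast
    have "bounded_linear (\<lambda>t. t *s v)"
      by (rule bounded_linear_intro[where K = "norm v"])
         (auto simp: vec_eq_iff algebra_simps norm_complex_scale)
    then have "((\<lambda>t. z + t *s v) has_derivative (\<lambda>h. 0 + h *s v)) (at t)"
      by (intro has_derivative_add has_derivative_const bounded_linear_imp_has_derivative)
    from has_derivative_compose[OF this D(1)]
    have "((\<lambda>t. f (z + t *s v)) has_derivative (\<lambda>h. D (h *s v))) (at t)" by simp
    also have "(\<lambda>h. D (h *s v)) = (*) (D v)" by (auto simp: D(2))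
    finally show ?thesis unfolding field_differentiable_def has_field_derivative_def by blast
  qed
  then show ?thesis using assms(2) by (simp add: holomorphic_on_def field_differentiable_at_within)
qed

text \<open>Cut the segment into \<open>L\<close> pieces, each short enough for the Bernstein
  inequality. Some piece carries its share of \<open>E\<close>, and the Remez inequality bounds
  \<open>\<Phi>\<close> on it; passing from there back to the piece that starts at \<open>y\<close>
  costs a factor \<open>C\<close> per step.\<close>

lemma segment_remez:
  fixes \<Phi> :: "complex ^ 'n \<Rightarrow> complex" and y v :: "real ^ 'n"
  assumes hol: "\<And>y v. norm y \<le> 1 \<Longrightarrow> norm v < \<epsilon> \<Longrightarrow> (\<lambda>t. \<Phi> (cvec y + t *s cvec v)) holomorphic_on ball 0 5"
    and bern: "\<And>y v A t. norm y \<le> 1 \<Longrightarrow> norm v < \<epsilon> \<Longrightarrow>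
       (\<And>\<tau>. \<tau> \<in> {0..1} \<Longrightarrow> norm (\<Phi> (cvec y + complex_of_real \<tau> *s cvec v)) \<le> A) \<Longrightarrow>
       t \<in> ball 0 5 \<Longrightarrow> norm (\<Phi> (cvec y + t *s cvec v)) \<le> C * A"
    and C: "C \<ge> 1" "C \<le> 3 ^ k" and L: "real L * \<epsilon> > 2"
    and y: "norm y \<le> 1" "norm (y + v) \<le> 1"
    and E: "E \<in> sets lebesgue" "E \<subseteq> {0..1}" "measure lebesgue E \<ge> \<delta>" "\<delta> > 0"
    and \<eta>: "\<And>t. t \<in> E \<Longrightarrow> norm (\<Phi> (cvec (y + t *\<^sub>R v))) \<le> \<eta>"
  shows "norm (\<Phi> (cvec y)) \<le> C ^ L * (4 * real (Suc k) * \<eta> * (10 * real (Suc k) / \<delta>) ^ k)"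
proof -
  have L0: "L > 0" using L by (cases L) auto
  define yi where "yi i = y + (real i / real L) *\<^sub>R v" for i
  define u where "u = (1 / real L) *\<^sub>R v"
  have yi: "norm (yi i) \<le> 1" if "i < L" for i
  proof -
    have "yi i = (1 - real i / real L) *\<^sub>R y + (real i / real L) *\<^sub>R (y + v)" by (simp add: yi_def algebra_simps)
    moreover have "(1 - real i / real L) *\<^sub>R y + (real i / real L) *\<^sub>R (y + v) \<in> cball 0 1"
      using convex_cball[of "0::real^'n" 1] y that L0 by (intro convexD_alt) auto
    ultimately show ?thesis by simp
  qed
  have "norm v \<le> 2" using norm_triangle_ineq4[of "y + v" y] y by simp
  then have u: "norm u < \<epsilon>" using L L0 by (simp add: u_def field_simps)
  define f where "f i t = \<Phi> (cvec (yi i) + t *s cvec u)" for i t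
  have f_real: "f i (of_real t) = \<Phi> (cvec (y + ((real i + t) / real L) *\<^sub>R v))" for i t
    by (simp add: f_def yi_def u_def cvec_add[symmetric] cvec_scaleR[symmetric] algebra_simps add_divide_distrib)
  have f_shift: "f (Suc i) t = f i (t + 1)" for i t
  proof -
    have "yi (Suc i) = yi i + u" by (simp add: yi_def u_def algebra_simps add_divide_distrib)
    then show ?thesis by (simp add: f_def cvec_add vector_sadd_rdistrib add_ac)
  qed
  have f_hol: "f i holomorphic_on ball 0 5" if "i < L" for i
    unfolding f_def[abs_def] by (rule hol[OF yi[OF that] u])
  have "\<exists>\<tau>\<in>{0..1}. \<forall>t\<in>{0..1}. norm (f i (of_real t)) \<le> norm (f i (of_real \<tau>))" if "i < L" for i
  proof (rule continuous_attains_sup)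
    have "continuous_on {0..1} (f i \<circ> complex_of_real)"
      by (intro continuous_on_compose continuous_intros
            continuous_on_subset[OF holomorphic_on_imp_continuous_on[OF f_hol[OF that]]]) auto
    then show "continuous_on {0..1} (\<lambda>t. norm (f i (of_real t)))"
      by (intro continuous_on_norm) (simp add: o_def)
  qed auto
  then obtain \<tau> where \<tau>: "\<And>i. i < L \<Longrightarrow> \<tau> i \<in> {0..1}"
     "\<And>i t. i < L \<Longrightarrow> t \<in> {0..1} \<Longrightarrow> norm (f i (of_real t)) \<le> norm (f i (of_real (\<tau> i)))" by metis
  define A where "A i = norm (f i (of_real (\<tau> i)))" for i
  have A: "t \<in> {0..1} \<Longrightarrow> norm (f i (of_real t)) \<le> A i" if "i < L" for i t
    using \<tau>(2)[OF that] by (simp add: A_def)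
  have fA: "norm (f i t) \<le> C * A i" if "i < L" "t \<in> ball 0 5" for i t
    unfolding f_def by (rule bern[OF yi[OF that(1)] u _ that(2)]) (use A[OF that(1)] in \<open>simp add: f_def\<close>)
  have "A 0 \<le> C ^ i * A i" if "i < L" for i
    using that
  proof (induction i)
    case (Suc i)
    \<comment> \<open>In the coordinate of piece \<open>Suc i\<close>, piece \<open>i\<close>
      occupies \<open>[-1, 0]\<close>, well inside the disc of radius 5.\<close>
    have "A i = norm (f (Suc i) (of_real (\<tau> i) - 1))" by (simp add: f_shift A_def)
    also have "\<dots> \<le> C * A (Suc i)"
    proof (rule fA)
      have "of_real (\<tau> i) - 1 = complex_of_real (\<tau> i - 1)" by simp
      then show "of_real (\<tau> i) - 1 \<in> ball (0::complex) 5" using \<tau>(1)[of i] Suc.prems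
        by (simp only: mem_ball dist_0_norm norm_of_real) auto
    qed (use Suc in auto)
    finally have "C ^ i * A i \<le> C ^ i * (C * A (Suc i))" using C by (intro mult_left_mono) auto
    then show ?case using Suc by (simp add: mult_ac)
  qed simp
  \<comment> \<open>Pigeonhole: the \<open>L\<close> pieces cover \<open>E\<close>.\<close>
  moreover have "\<exists>i<L. \<delta> / real L \<le> measure lebesgue (E \<inter> {real i / real L..real (Suc i) / real L})"
  proof (rule ccontr)
    assume neg: "\<not> ?thesis"
    let ?J = "\<lambda>i. E \<inter> {real i / real L..real (Suc i) / real L}"
    have "E \<subseteq> (\<Union>i<L. ?J i)"
    proof
      fix t assume t: "t \<in> E"
      then have t01: "0 \<le> t" "t \<le> 1" using E(2) by auto
      show "t \<in> (\<Union>i<L. ?J i)"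
      proof (cases "t = 1")
        case True
        then show ?thesis using t L0 by (intro UN_I[of "L - 1"]) auto
      next
        case False
        define i where "i = nat \<lfloor>t * real L\<rfloor>"
        have i: "real i \<le> t * real L" "t * real L < real i + 1"
          unfolding i_def using t01 L0 by (auto simp: of_nat_nat)
        have "t * real L < 1 * real L" using False t01 L0 by (intro mult_strict_right_mono) auto
        then have "i < L" using i by linarith
        then show ?thesis using t i L0 by (intro UN_I[of i]) (auto simp: field_simps)
      qed
    qed
    then have "measure lebesgue E \<le> measure lebesgue (\<Union>i<L. ?J i)"
      using E(1) by (intro measure_mono_fmeasurable fmeasurable.finite_UN)
         (auto intro!: bounded_set_imp_lmeasurable bounded_Int)
    also have "\<dots> \<le> (\<Sum>i<L. measure lebesgue (?J i))"
      using E(1) by (intro measure_UNION_le) auto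
    also have "\<dots> < (\<Sum>i<L. \<delta> / real L)"
      using neg L0 by (intro sum_strict_mono) (auto simp: not_le lessThan_empty_iff)
    also have "\<dots> = \<delta>" using L0 by simp
    finally show False using E(3) by simp
  qed
  ultimately obtain i where i: "i < L" "\<delta> / real L \<le> measure lebesgue (E \<inter> {real i / real L..real (Suc i) / real L})"
    and A0: "A 0 \<le> C ^ i * A i" by blast
  \<comment> \<open>Stretching the piece to unit length turns the share \<open>\<delta> / L\<close>
    back into \<open>\<delta>\<close>.\<close>
  define Ei where "Ei = (\<lambda>x. real L *\<^sub>R x + (- real i)) ` (E \<inter> {real i / real L..real (Suc i) / real L})"
  have Ei_measure: "measure lebesgue Ei \<ge> \<delta>"
    using i(2) L0 unfolding Ei_def by (subst measure_lebesgue_affine) (simp add: field_simps)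
  \<comment> \<open>Sets outside the sigma-algebra have \<open>measure\<close> 0, so a positive
    value already yields measurability.\<close>
  have Ei_sets: "Ei \<in> sets lebesgue" using Ei_measure E(4) measure_notin_sets by fastforce
  have "A i \<le> 4 * real (Suc k) * \<eta> * (10 * real (Suc k) / \<delta>) ^ k"
  proof (rule remez_holomorphic[OF f_hol[OF i(1)] C(2) fA[OF i(1)] A[OF i(1)] _ Ei_sets _ Ei_measure E(4)])
    show "\<exists>t\<in>{0..1}. norm (f i (of_real t)) = A i" using \<tau>(1)[OF i(1)] by (auto simp: A_def)
    show "Ei \<subseteq> {0..1}" using L0 by (auto simp: Ei_def field_simps)
    fix t assume "t \<in> Ei"
    then obtain x where x: "x \<in> E" "t = real L * x - real i" by (auto simp: Ei_def)
    then have "(real i + t) / real L = x" using L0 by simp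
    then show "norm (f i (of_real t)) \<le> \<eta>" unfolding f_real using \<eta>[OF x(1)] by simp
  qed
  then have "C ^ i * A i \<le> C ^ i * (4 * real (Suc k) * \<eta> * (10 * real (Suc k) / \<delta>) ^ k)"
    using C by (intro mult_left_mono) auto
  also have "\<dots> \<le> C ^ L * (4 * real (Suc k) * \<eta> * (10 * real (Suc k) / \<delta>) ^ k)"
  proof (rule mult_right_mono)
    show "C ^ i \<le> C ^ L" using C i by (intro power_increasing) auto
    have "E \<noteq> {}" using E by auto
    then have "\<eta> \<ge> 0" using \<eta> norm_ge_zero order_trans by blast
    then show "0 \<le> 4 * real (Suc k) * \<eta> * (10 * real (Suc k) / \<delta>) ^ k" using E(4) by simp
  qed
  finally have "A 0 \<le> C ^ L * (4 * real (Suc k) * \<eta> * (10 * real (Suc k) / \<delta>) ^ k)" using A0 by linarith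
  moreover have "norm (\<Phi> (cvec y)) \<le> A 0"
    using A[OF L0, of 0] f_real[of 0 0] by simp
  ultimately show ?thesis by linarith
qed

section \<open>Segments from a given point that meet \<open>\<omega>\<close> in large length\<close>

lemma lebesgue_inner_borel:
  assumes "\<omega> \<in> sets lebesgue"
  obtains W where "W \<in> sets borel" "W \<subseteq> \<omega>" "measure lebesgue W = measure lebesgue \<omega>"
proof -
  obtain S N N' where *: "\<omega> = S \<union> N" "N \<subseteq> N'" "N' \<in> null_sets lborel" "S \<in> sets lborel"
    using sets_completionE[OF assms] .
  have "N \<in> null_sets lebesgue" using *(2,3) by (metis null_sets_completionI null_sets_completion_subset)
  then have "measure lebesgue \<omega> = measure lebesgue S"
    using * by (simp add: measure_Un_null_set)
  then show thesis using that * by auto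
qed

text \<open>Homotheties centred at \<open>y\<close> with ratio \<open>t\<close> near 1 map the ball
  into itself and almost preserve volume, so for each such \<open>t\<close> about a fraction
  \<open>q\<close> of the points \<open>z\<close> is sent into \<open>\<omega>\<close>. Fubini's
  theorem exchanges the roles of \<open>t\<close> and \<open>z\<close>. One factor \<open>q\<close>
  is this fraction, the other comes from the length \<open>\<theta>\<close> of the range of
  \<open>t\<close>.\<close>

lemma exists_good_segment:
  fixes x y :: "'a::euclidean_space"
  assumes \<omega>: "\<omega> \<in> sets lebesgue" "\<omega> \<subseteq> ball x \<rho>" "measure lebesgue \<omega> > 0" and y: "y \<in> ball x \<rho>"
  defines "q \<equiv> measure lebesgue \<omega> / measure lebesgue (ball x \<rho>)"
  obtains z E where "z \<in> ball x \<rho>" "E \<in> sets lebesgue" "E \<subseteq> {0..1}"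
    "\<And>t. t \<in> E \<Longrightarrow> y + t *\<^sub>R (z - y) \<in> \<omega>" "measure lebesgue E \<ge> q\<^sup>2 / (8 * DIM('a))"
proof -
  define B where "B = ball x \<rho>"
  define n where "n = real DIM('a)"
  have n: "n \<ge> 1" using DIM_positive[where 'a='a] unfolding n_def by linarith
  \<comment> \<open>Sections and preimages are taken below, also under maps from the line into
    space, where preimages of Lebesgue sets need not be measurable; a Borel subset of the same
    measure avoids this.\<close>
  obtain W where W: "W \<in> sets borel" "W \<subseteq> \<omega>" "measure lebesgue W = measure lebesgue \<omega>"
    using lebesgue_inner_borel[OF \<omega>(1)] .
  have Blm: "B \<in> lmeasurable" by (simp add: B_def)
  have WB: "W \<subseteq> B" using W \<omega> by (auto simp: B_def)
  have Wlm: "W \<in> lmeasurable"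
    using W(1) bounded_subset[OF _ WB] by (intro bounded_set_imp_lmeasurable) (auto simp: B_def)
  define b where "b = measure lebesgue B"
  have wb: "measure lebesgue W \<le> b" unfolding b_def using WB Blm W(1) by (intro measure_mono_fmeasurable) auto
  have b: "b > 0" using wb \<omega>(3) W(3) by simp
  have qb: "measure lebesgue W = q * b" using b W(3) by (simp add: q_def b_def B_def)
  have q: "0 < q" "q \<le> 1" using wb qb b \<omega>(3) W(3) by (auto simp: q_def b_def B_def)
  \<comment> \<open>By Bernoulli's inequality the volume factor \<open>t ^ DIM('a)\<close> is then
    at least \<open>1 - n * \<theta> = 1 - q / 2\<close>.\<close>
  define \<theta> where "\<theta> = q / (2 * n)"
  have \<theta>: "\<theta> > 0" "\<theta> \<le> 1/2" "n * \<theta> = q / 2" using q n by (auto simp: \<theta>_def field_simps)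
  define Z where "Z = {p. fst p \<in> B \<and> snd p \<in> {1-\<theta>..1} \<and> y + snd p *\<^sub>R (fst p - y) \<in> W}"
  have Z: "Z \<in> sets (lborel \<Otimes>\<^sub>M lborel)"
  proof -
    have [measurable]: "B \<in> sets borel" "W \<in> sets borel" using W(1) by (auto simp: B_def)
    have "{p \<in> space (borel \<Otimes>\<^sub>M borel). fst p \<in> B \<and> snd p \<in> {1-\<theta>..1} \<and> y + snd p *\<^sub>R (fst p - y) \<in> W} \<in> sets (borel \<Otimes>\<^sub>M borel)"
      by measurable
    then show ?thesis by (simp add: Z_def space_pair_measure cong: sets_pair_measure_cong)
  qed
  define At where "At t = {z \<in> B. y + t *\<^sub>R (z - y) \<in> W}" for t
  have At: "measure lebesgue (At t) \<ge> q / 2 * b" "At t \<in> sets borel" if t: "t \<in> {1-\<theta>..1}" for t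
  proof -
    have "(\<lambda>z. y + t *\<^sub>R (z - y)) \<in> borel_measurable borel" by measurable
    from measurable_sets[OF this W(1)] have "B \<inter> (\<lambda>z. y + t *\<^sub>R (z - y)) -` W \<in> sets borel"
      by (simp add: B_def)
    then show Atb: "At t \<in> sets borel" by (simp add: At_def Int_def vimage_def)
    have t0: "t > 0" "t \<le> 1" using t \<theta> by auto
    have "At t \<subseteq> B" "bounded B" by (auto simp: At_def B_def)
    then have lm: "At t \<in> lmeasurable"
      using Atb bounded_subset by (intro bounded_set_imp_lmeasurable) auto
    then have "B - At t \<in> lmeasurable" using Blm by (rule fmeasurable.Diff[rotated])
    note lm = lm this
    \<comment> \<open>The bound is proved for the complement: points of \<open>B\<close> outside
      \<open>At t\<close> are sent into \<open>B - W\<close>, whose measure is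
      \<open>(1 - q) * b\<close>; convexity of the ball keeps their images in
      \<open>B\<close>.\<close>
    have "(\<lambda>z. t *\<^sub>R z + (1 - t) *\<^sub>R y) ` (B - At t) \<subseteq> B - W"
    proof
      fix p assume "p \<in> (\<lambda>z. t *\<^sub>R z + (1 - t) *\<^sub>R y) ` (B - At t)"
      then obtain z where z: "z \<in> B" "z \<notin> At t" "p = t *\<^sub>R z + (1 - t) *\<^sub>R y" by auto
      have "p \<in> B" unfolding z(3) using z(1) y t0 convex_ball[of x \<rho>] by (intro convexD) (auto simp: B_def)
      moreover have "p = y + t *\<^sub>R (z - y)" by (simp add: z(3) algebra_simps)
      ultimately show "p \<in> B - W" using z by (auto simp: At_def)
    qed
    then have "measure lebesgue ((\<lambda>z. t *\<^sub>R z + (1 - t) *\<^sub>R y) ` (B - At t)) \<le> measure lebesgue (B - W)"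
      using Blm Wlm by (cases "(\<lambda>z. t *\<^sub>R z + (1 - t) *\<^sub>R y) ` (B - At t) \<in> sets lebesgue")
        (auto intro!: measure_mono_fmeasurable simp: measure_notin_sets)
    also have "measure lebesgue (B - W) = (1 - q) * b"
      using measurable_measure_Diff[OF Blm fmeasurableD[OF Wlm] WB] qb by (simp add: b_def algebra_simps)
    also have "measure lebesgue ((\<lambda>z. t *\<^sub>R z + (1 - t) *\<^sub>R y) ` (B - At t)) = t ^ DIM('a) * measure lebesgue (B - At t)"
      using t0 by (subst measure_lebesgue_affine) simp
    finally have 1: "t ^ DIM('a) * measure lebesgue (B - At t) \<le> (1 - q) * b" .
    have "1 - q / 2 \<le> t ^ DIM('a)"
    proof -
      have "1 - q / 2 = 1 + real DIM('a) * (- \<theta>)" using \<theta>(3) by (simp add: n_def)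
      also have "\<dots> \<le> (1 + - \<theta>) ^ DIM('a)" by (rule Bernoulli_inequality) (use \<theta> in auto)
      also have "\<dots> \<le> t ^ DIM('a)" using t \<theta> by (intro power_mono) auto
      finally show ?thesis .
    qed
    then have "(1 - q / 2) * measure lebesgue (B - At t) \<le> (1 - q) * b"
      using mult_right_mono[of "1 - q/2" "t ^ DIM('a)" "measure lebesgue (B - At t)"] 1 by simp
    \<comment> \<open>Splitting off the factor \<open>1 - q / 2\<close> allows it to be cancelled
      against the volume factor.\<close>
    also have "(1 - q) * b \<le> (1 - q / 2) * ((1 - q / 2) * b)"
    proof -
      have "1 - q \<le> (1 - q / 2) * (1 - q / 2)" by (simp add: algebra_simps)
      then show ?thesis using mult_right_mono[of "1 - q" "(1 - q / 2) * (1 - q / 2)" b] b by simp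
    qed
    finally have "measure lebesgue (B - At t) \<le> (1 - q / 2) * b" using q by simp
    moreover have "measure lebesgue (B - At t) = b - measure lebesgue (At t)"
      using measurable_measure_Diff[OF Blm fmeasurableD[OF lm(1)]] by (simp add: b_def At_def subset_iff)
    ultimately show "measure lebesgue (At t) \<ge> q / 2 * b" by (simp add: algebra_simps)
  qed
  define Ez where "Ez z = {t \<in> {1-\<theta>..1}. y + t *\<^sub>R (z - y) \<in> W}" for z
  have Ez: "Ez z \<in> sets borel" for z
  proof -
    have "(\<lambda>t. y + t *\<^sub>R (z - y)) \<in> borel_measurable borel" by measurable
    from measurable_sets[OF this W(1)] have "{1-\<theta>..1} \<inter> (\<lambda>t. y + t *\<^sub>R (z - y)) -` W \<in> sets borel" by simp
    then show ?thesis by (simp add: Ez_def Int_def vimage_def)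
  qed
  have Ez_lm: "Ez z \<in> lmeasurable" for z
    using Ez[of z] by (intro bounded_set_imp_lmeasurable) (auto simp: Ez_def intro: bounded_subset[of "{1-\<theta>..1}"])
  \<comment> \<open>Measuring \<open>Z\<close> by its sections at fixed \<open>t\<close> shows that
    the average over \<open>z\<close> of the lengths is at least \<open>\<theta> * q / 2\<close>;
    half of this is claimed, which makes the contradiction strict.\<close>
  have "\<exists>z\<in>B. measure lebesgue (Ez z) \<ge> \<theta> * q / 4"
  proof (rule ccontr)
    assume neg: "\<not> ?thesis"
    have "emeasure (lborel \<Otimes>\<^sub>M lborel) Z = (\<integral>\<^sup>+ z. emeasure lborel (Pair z -` Z) \<partial>lborel)"
      by (rule lborel.emeasure_pair_measure_alt[OF Z])
    also have "\<dots> \<le> (\<integral>\<^sup>+ z. ennreal (\<theta> * q / 4) * indicator B z \<partial>lborel)"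
    proof (rule nn_integral_mono)
      fix z :: 'a
      show "emeasure lborel (Pair z -` Z) \<le> ennreal (\<theta> * q / 4) * indicator B z"
      proof (cases "z \<in> B")
        case True
        then have "Pair z -` Z = Ez z" by (auto simp: Z_def Ez_def)
        moreover have "emeasure lborel (Ez z) = ennreal (measure lebesgue (Ez z))"
          using emeasure_eq_measure2[OF Ez_lm[of z]] Ez[of z] by simp
        moreover have "measure lebesgue (Ez z) \<le> \<theta> * q / 4" using neg True by force
        ultimately show ?thesis using True by (simp add: ennreal_leI)
      next
        case False
        then have "Pair z -` Z = {}" by (auto simp: Z_def)
        then show ?thesis by simp
      qed
    qed
    also have "\<dots> = ennreal (\<theta> * q / 4) * emeasure lborel B" by (intro nn_integral_cmult_indicator) (simp add: B_def)
    also have "emeasure lborel B = ennreal b"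
      using emeasure_eq_measure2[OF Blm] by (simp add: b_def B_def)
    finally have up: "emeasure (lborel \<Otimes>\<^sub>M lborel) Z \<le> ennreal (\<theta> * q / 4 * b)"
      using \<theta> q b by (subst ennreal_mult) auto
    have "ennreal (\<theta> * (q / 2 * b)) = (\<integral>\<^sup>+ t. ennreal (q / 2 * b) * indicator {1-\<theta>..1} t \<partial>lborel)"
      using \<theta> q b by (subst nn_integral_cmult_indicator) (auto simp: mult_ac simp flip: ennreal_mult)
    also have "\<dots> \<le> (\<integral>\<^sup>+ t. emeasure lborel ((\<lambda>z. (z, t)) -` Z) \<partial>lborel)"
    proof (rule nn_integral_mono)
      fix t :: real
      show "ennreal (q / 2 * b) * indicator {1-\<theta>..1} t \<le> emeasure lborel ((\<lambda>z. (z, t)) -` Z)"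
      proof (cases "t \<in> {1-\<theta>..1}")
        case True
        then have "(\<lambda>z. (z, t)) -` Z = At t" by (auto simp: Z_def At_def)
        moreover have "At t \<subseteq> B" "bounded B" by (auto simp: At_def B_def)
        then have "At t \<in> lmeasurable"
          using At(2)[OF True] bounded_subset by (intro bounded_set_imp_lmeasurable) auto
        then have "emeasure lborel (At t) = ennreal (measure lebesgue (At t))"
          using emeasure_eq_measure2[of "At t" lebesgue] At(2)[OF True] by simp
        ultimately show ?thesis using True At(1)[OF True] by (simp add: ennreal_leI)
      qed simp
    qed
    also have "\<dots> = emeasure (lborel \<Otimes>\<^sub>M lborel) Z"
      by (rule lborel_pair.emeasure_pair_measure_alt2[OF Z, symmetric])
    finally have "ennreal (\<theta> * (q / 2 * b)) \<le> ennreal (\<theta> * q / 4 * b)" using up by order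
    then have "\<theta> * (q / 2 * b) \<le> \<theta> * q / 4 * b" using \<theta> q b by (subst (asm) ennreal_le_iff) auto
    moreover have "\<theta> * q * b > 0" using \<theta> q b by simp
    ultimately show False by (simp add: mult_ac)
  qed
  then obtain z where z: "z \<in> B" "measure lebesgue (Ez z) \<ge> \<theta> * q / 4" by blast
  show thesis
  proof (rule that[of z "Ez z"])
    show "z \<in> ball x \<rho>" using z by (simp add: B_def)
    show "Ez z \<in> sets lebesgue" using Ez_lm[of z] by auto
    show "Ez z \<subseteq> {0..1}" using \<theta> by (auto simp: Ez_def)
    show "y + t *\<^sub>R (z - y) \<in> \<omega>" if "t \<in> Ez z" for t using that W(2) by (auto simp: Ez_def)
    have "\<theta> * q / 4 = q\<^sup>2 / (8 * DIM('a))" by (simp add: \<theta>_def n_def power2_eq_square)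
    then show "q\<^sup>2 / (8 * DIM('a)) \<le> measure lebesgue (Ez z)" using z(2) by simp
  qed
qed

text \<open>A real supremum is an upper bound only for bounded sets. Boundedness holds because the
  closed unit ball is compact inside the larger domain.\<close>

lemma holo_n_cvec_bdd_above:
  assumes "\<And>j. j < N \<Longrightarrow> holo_n (ball 0 (1 + r)) (F j)" "r > 0" "A \<subseteq> ball 0 1"
  shows "bdd_above ((\<lambda>y. norm (\<Sum>j<N. c j * F j (cvec y))) ` A)"
proof -
  have "continuous_on (ball 0 (1 + r)) (F j)" if "j < N" for j
    using assms(1)[OF that] has_derivative_continuous_on has_derivative_continuous
    unfolding holo_n_def continuous_on_eq_continuous_within by (meson continuous_at_imp_continuous_within)
  moreover have "continuous_on (cball 0 1) cvec" unfolding cvec_def by (intro continuous_intros)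
  moreover have "cvec ` cball 0 1 \<subseteq> ball 0 (1 + r)" using assms(2) by auto
  ultimately have "continuous_on (cball 0 1) (\<lambda>y. F j (cvec y))" if "j < N" for j
    using that by (metis continuous_on_compose2)
  then have "continuous_on (cball 0 1) (\<lambda>y. norm (\<Sum>j<N. c j * F j (cvec y)))"
    by (intro continuous_intros) auto
  then have "compact ((\<lambda>y. norm (\<Sum>j<N. c j * F j (cvec y))) ` cball 0 1)"
    by (intro compact_continuous_image) auto
  then have "bdd_above ((\<lambda>y. norm (\<Sum>j<N. c j * F j (cvec y))) ` cball 0 1)"
    by (intro bounded_imp_bdd_above compact_imp_bounded)
  then show ?thesis
    by (rule bdd_above_mono) (use assms(3) in \<open>auto intro!: image_mono simp: subset_iff less_imp_le\<close>)
qed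

text \<open>Since \<open>2 / q \<ge> 2\<close>, any constant \<open>D = 2 powr (log 2 D)\<close> is
  at most a power of \<open>2 / q\<close> with the same exponent. This is why the base needs a
  factor greater than 1.\<close>

lemma constant_absorbed_by_powr:
  fixes q D :: real
  assumes "0 < q" "q \<le> 1" "D \<ge> 1"
  shows "D * (1 / q\<^sup>2) ^ k \<le> (2 / q) powr (2 * real k + log 2 D)"
proof -
  have "(1 / q\<^sup>2) ^ k = (1 / q) ^ (2 * k)" by (simp add: power_mult power_divide)
  also have "\<dots> \<le> (2 / q) ^ (2 * k)" using assms by (intro power_mono divide_right_mono) auto
  also have "\<dots> = (2 / q) powr (2 * real k)" using assms by (simp add: powr_realpow[symmetric])
  finally have 1: "(1 / q\<^sup>2) ^ k \<le> (2 / q) powr (2 * real k)" .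
  have "D = 2 powr (log 2 D)" using assms by simp
  also have "\<dots> \<le> (2 / q) powr (log 2 D)" using assms by (intro powr_mono2) (auto simp: field_simps)
  finally have "D * (1 / q\<^sup>2) ^ k \<le> (2 / q) powr (log 2 D) * (2 / q) powr (2 * real k)"
    using 1 assms by (intro mult_mono) auto
  then show ?thesis by (simp add: powr_add mult.commute)
qed

section \<open>Choice of the constants and the final inequality\<close>

theorem theorem1p4:
  shows "\<exists>d::real. d > 0 \<and>
    (\<forall>(m::nat) (r0::real) (U :: (nat \<Rightarrow> real) set) (N::nat)
        (Fs :: nat \<Rightarrow> (nat \<Rightarrow> real) \<Rightarrow> complex ^ 'n \<Rightarrow> complex).
       r0 > 0 \<longrightarrow> open_Rm m U \<longrightarrow>
       (\<forall>j<N. \<forall>l\<in>U. holo_n (ball 0 (1 + r0)) (Fs j l)) \<longrightarrow>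
       (\<forall>j<N. param_analytic m U (ball 0 (1 + r0)) (Fs j)) \<longrightarrow>
       (\<forall>K. compact K \<and> K \<subseteq> U \<longrightarrow>
          (\<exists>\<gamma>>0. \<forall>l\<in>K. \<forall>c :: nat \<Rightarrow> complex. \<forall>(x :: real ^ 'n) (\<rho>::real) \<omega>.
              ball x \<rho> \<subseteq> ball 0 1 \<longrightarrow> \<omega> \<in> sets lebesgue \<longrightarrow> \<omega> \<subseteq> ball x \<rho> \<longrightarrow>
              measure lebesgue \<omega> > 0 \<longrightarrow>
              (SUP y\<in>ball x \<rho>. norm (\<Sum>j<N. c j * Fs j l (cvec y)))
                \<le> (d * measure lebesgue (ball x \<rho>) / measure lebesgue \<omega>) powr \<gamma>
                   * (SUP y\<in>\<omega>. norm (\<Sum>j<N. c j * Fs j l (cvec y))))))"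
proof (rule exI[of _ 2], intro conjI allI impI, simp, elim conjE)
  fix m N :: nat and r0 :: real and U K :: "(nat \<Rightarrow> real) set"
    and Fs :: "nat \<Rightarrow> (nat \<Rightarrow> real) \<Rightarrow> complex ^ 'n \<Rightarrow> complex"
  assume r0: "r0 > 0" and U: "open_Rm m U"
    and holo: "\<forall>j<N. \<forall>l\<in>U. holo_n (ball 0 (1 + r0)) (Fs j l)"
    and analytic: "\<forall>j<N. param_analytic m U (ball 0 (1 + r0)) (Fs j)"
    and K: "compact K" "K \<subseteq> U"
  obtain \<epsilon>0 C where \<epsilon>0: "\<epsilon>0 > 0" and C: "C \<ge> 1"
    and bern: "\<And>l y v e A t. l \<in> K \<Longrightarrow> norm y \<le> 1 \<Longrightarrow> norm v < \<epsilon>0 \<Longrightarrow>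
       (\<And>\<tau>. \<tau> \<in> {0..1} \<Longrightarrow> norm (\<Sum>j<N. e j * Fs j l (cvec y + complex_of_real \<tau> *s cvec v)) \<le> A) \<Longrightarrow>
       t \<in> ball 0 5 \<Longrightarrow> norm (\<Sum>j<N. e j * Fs j l (cvec y + t *s cvec v)) \<le> C * A"
    by (rule uniform_bernstein[OF U K, of "ball 0 (1 + r0)" N Fs]) (use r0 analytic in auto)
  \<comment> \<open>The bound \<open>r0 / 5\<close> keeps the extended segment, with
    \<open>norm t < 5\<close>, inside the ball of radius \<open>1 + r0\<close>.\<close>
  define \<epsilon> where "\<epsilon> = min \<epsilon>0 (r0 / 5)"
  have \<epsilon>: "\<epsilon> > 0" "\<epsilon> \<le> \<epsilon>0" "5 * \<epsilon> \<le> r0" using \<epsilon>0 r0 by (auto simp: \<epsilon>_def)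
  \<comment> \<open>Two points of the unit ball are at distance at most 2, so \<open>L\<close>
    pieces are shorter than \<open>\<epsilon>\<close>.\<close>
  obtain L :: nat where L: "real L * \<epsilon> > 2" using reals_Archimedean3[OF \<epsilon>(1)] by blast
  obtain k where k: "C \<le> 3 ^ k" using real_arch_pow[of 3 C] by (auto intro: less_imp_le)
  define n where "n = real CARD('n)"
  \<comment> \<open>The factor \<open>80 * n\<close> is the 10 of the Remez bound times the
    \<open>8 * n\<close> from the length of \<open>E\<close>.\<close>
  define D0 where "D0 = C ^ L * (4 * real (Suc k)) * (80 * n * real (Suc k)) ^ k"
  \<comment> \<open>Each of the \<open>k\<close> factors \<open>1 / q\<^sup>2\<close> contributes 2
    to the exponent. Adding 2 to \<open>D0\<close> makes the constant at least 1 and its logarithm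
    positive, so \<open>\<gamma> > 0\<close> even when \<open>k = 0\<close>.\<close>
  define \<gamma> where "\<gamma> = 2 * real k + log 2 (D0 + 2)"
  have n: "n \<ge> 1" by (simp add: n_def Suc_le_eq)
  have D0: "D0 \<ge> 0" using C n by (simp add: D0_def)
  then have "log 2 (D0 + 2) > 0" by simp
  then have "\<gamma> > 0" by (simp add: \<gamma>_def add_nonneg_pos)
  moreover have "(SUP y\<in>ball x \<rho>. norm (\<Sum>j<N. c j * Fs j l (cvec y)))
      \<le> (2 * measure lebesgue (ball x \<rho>) / measure lebesgue \<omega>) powr \<gamma> * (SUP y\<in>\<omega>. norm (\<Sum>j<N. c j * Fs j l (cvec y)))"
    if l: "l \<in> K" and x: "ball x \<rho> \<subseteq> ball 0 1" and \<omega>: "\<omega> \<in> sets lebesgue" "\<omega> \<subseteq> ball x \<rho>" "measure lebesgue \<omega> > 0"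
    for l c and x :: "real ^ 'n" and \<rho> \<omega>
  proof -
    define \<Phi> where "\<Phi> z = (\<Sum>j<N. c j * Fs j l z)" for z
    define q where "q = measure lebesgue \<omega> / measure lebesgue (ball x \<rho>)"
    define \<eta> where "\<eta> = (SUP y\<in>\<omega>. norm (\<Phi> (cvec y)))"
    have \<omega>_ne: "\<omega> \<noteq> {}" using \<omega>(3) by auto
    have le_ball: "measure lebesgue \<omega> \<le> measure lebesgue (ball x \<rho>)"
      using \<omega> by (intro measure_mono_fmeasurable) auto
    then have "measure lebesgue (ball x \<rho>) > 0" using \<omega>(3) by linarith
    then have q: "0 < q" "q \<le> 1" using \<omega>(3) le_ball by (auto simp: q_def divide_le_eq)
    have bdd: "bdd_above ((\<lambda>y. norm (\<Phi> (cvec y))) ` \<omega>)"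
      unfolding \<Phi>_def using holo l K r0 \<omega>(2) x by (intro holo_n_cvec_bdd_above) auto
    have \<eta>: "norm (\<Phi> (cvec y)) \<le> \<eta>" if "y \<in> \<omega>" for y
      unfolding \<eta>_def by (rule cSUP_upper[OF that bdd])
    have \<eta>0: "\<eta> \<ge> 0" using \<eta> \<omega>_ne norm_ge_zero order_trans by blast
    have hol: "(\<lambda>t. \<Phi> (cvec y + t *s cvec v)) holomorphic_on ball 0 5" if "norm y \<le> 1" "norm v < \<epsilon>" for y v
    proof -
      have "cvec y + t *s cvec v \<in> ball 0 (1 + r0)" if t: "t \<in> ball 0 5" for t
      proof -
        have "norm t * norm v \<le> 5 * norm v" using t by (intro mult_right_mono) auto
        then show ?thesis
          using norm_triangle_ineq[of "cvec y" "t *s cvec v"] that \<open>norm y \<le> 1\<close> \<open>norm v < \<epsilon>\<close> \<epsilon>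
          by (simp add: norm_complex_scale)
      qed
      then have "(\<lambda>t. Fs j l (cvec y + t *s cvec v)) holomorphic_on ball 0 5" if "j < N" for j
        using holo l K that by (intro holo_n_along_line[of "ball 0 (1 + r0)"]) auto
      then show ?thesis unfolding \<Phi>_def by (intro holomorphic_intros) auto
    qed
    have main: "norm (\<Phi> (cvec y)) \<le> (2 / q) powr \<gamma> * \<eta>" if y: "y \<in> ball x \<rho>" for y
    proof -
      obtain z E where z: "z \<in> ball x \<rho>" and E: "E \<in> sets lebesgue" "E \<subseteq> {0..1}"
        "\<And>t. t \<in> E \<Longrightarrow> y + t *\<^sub>R (z - y) \<in> \<omega>" "measure lebesgue E \<ge> q\<^sup>2 / (8 * DIM(real ^ 'n))"
        using exists_good_segment[OF \<omega> y] unfolding q_def by metis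
      define \<delta> where "\<delta> = q\<^sup>2 / (8 * n)"
      have \<delta>: "\<delta> > 0" "measure lebesgue E \<ge> \<delta>" using E(4) q n by (auto simp: \<delta>_def n_def)
      have "norm (\<Phi> (cvec y)) \<le> C ^ L * (4 * real (Suc k) * \<eta> * (10 * real (Suc k) / \<delta>) ^ k)"
      proof (rule segment_remez[OF hol _ C k L _ _ E(1,2) \<delta>(2,1)])
        show "norm (\<Phi> (cvec y + t *s cvec v)) \<le> C * A"
          if "norm y \<le> 1" "norm v < \<epsilon>" "t \<in> ball 0 5"
            "\<And>\<tau>. \<tau> \<in> {0..1} \<Longrightarrow> norm (\<Phi> (cvec y + complex_of_real \<tau> *s cvec v)) \<le> A" for y v A t
          using bern[OF l, of y v c A t] that \<epsilon>(2) unfolding \<Phi>_def by force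
        show "norm y \<le> 1" "norm (y + (z - y)) \<le> 1" using x y z by (auto simp: subset_iff less_imp_le)
        show "norm (\<Phi> (cvec (y + t *\<^sub>R (z - y)))) \<le> \<eta>" if "t \<in> E" for t using \<eta> E(3)[OF that] by blast
      qed
      also have "10 * real (Suc k) / \<delta> = (80 * n * real (Suc k)) * (1 / q\<^sup>2)" by (simp add: \<delta>_def)
      also have "C ^ L * (4 * real (Suc k) * \<eta> * ((80 * n * real (Suc k)) * (1 / q\<^sup>2)) ^ k) = D0 * (1 / q\<^sup>2) ^ k * \<eta>"
        by (simp only: D0_def power_mult_distrib mult_ac)
      also have "\<dots> \<le> (D0 + 2) * (1 / q\<^sup>2) ^ k * \<eta>"
        using q \<eta>0 by (intro mult_right_mono) auto
      also have "\<dots> \<le> (2 / q) powr \<gamma> * \<eta>"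
        unfolding \<gamma>_def using D0 q \<eta>0 by (intro mult_right_mono constant_absorbed_by_powr) auto
      finally show ?thesis .
    qed
    have "2 * measure lebesgue (ball x \<rho>) / measure lebesgue \<omega> = 2 / q" by (simp add: q_def)
    moreover have "ball x \<rho> \<noteq> {}" using \<omega>_ne \<omega>(2) by blast
    then have "(SUP y\<in>ball x \<rho>. norm (\<Phi> (cvec y))) \<le> (2 / q) powr \<gamma> * \<eta>"
      by (rule cSUP_least) (rule main)
    ultimately show ?thesis by (simp add: \<eta>_def \<Phi>_def)
  qed
  ultimately show "\<exists>\<gamma>>0. \<forall>l\<in>K. \<forall>c :: nat \<Rightarrow> complex. \<forall>(x :: real ^ 'n) (\<rho>::real) \<omega>.
              ball x \<rho> \<subseteq> ball 0 1 \<longrightarrow> \<omega> \<in> sets lebesgue \<longrightarrow> \<omega> \<subseteq> ball x \<rho> \<longrightarrow>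
              measure lebesgue \<omega> > 0 \<longrightarrow>
              (SUP y\<in>ball x \<rho>. norm (\<Sum>j<N. c j * Fs j l (cvec y)))
                \<le> (2 * measure lebesgue (ball x \<rho>) / measure lebesgue \<omega>) powr \<gamma>
                   * (SUP y\<in>\<omega>. norm (\<Sum>j<N. c j * Fs j l (cvec y)))"
    by (intro exI[of _ \<gamma>] conjI ballI allI impI) auto
qed

end
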